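(* If $r_S$ is the radius of starlikeness of $\mathcal{M}(1)$, then $$4\sqrt2-5\le r_S\le\frac13\sqrt{\frac13\left(37-8\sqrt{10}\right)}.$$
   Context: $\mathbb{D}=\{z\in\mathbb{C}:|z|<1\}$. $\mathcal{M}(1)$ is the set of all harmonic functions $f=h+\overline{g}$ in $\mathbb{D}$, with $h(z)=z+\sum_{n\ge2}a_nz^n$ and $g(z)=\sum_{n\ge1}b_nz^n$ analytic in $\mathbb{D}$, such that $g'(z)=zh'(z)$ and $\operatorname{Re}\left(1+\frac{zh''(z)}{h'(z)}\right)>-\frac12$ for all $z\in\mathbb{D}$ (in particular $h'$ has no zeros in $\mathbb{D}$). The radius of starlikeness of a class of harmonic functions in $\mathbb{D}$ is the largest number $r_0\in(0,1]$ such that for every $0<r\le r_0$ every function in the class maps the disk $|z|<r$ onto a domain starlike with respect to the origin. *)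

theory Defs
  imports "HOL-Complex_Analysis.Complex_Analysis"
begin

text \<open>
  The class \<open>M(1)\<close>.  Its members are total functions of which only the values on the open unit
  disk \<open>ball 0 1\<close> matter.  The conditions on \<open>a\<close> and \<open>b\<close> say \<open>h(z) = z + a\<^sub>2 z\<^sup>2 + \<dots>\<close> and
  \<open>g(z) = b\<^sub>1 z + b\<^sub>2 z\<^sup>2 + \<dots>\<close>.  The nonvanishing of \<open>h'\<close> has to be stated explicitly, because
  \<open>x / 0 = 0\<close> would make the condition on the real part true at a zero of \<open>h'\<close>.
\<close>

definition M1 :: "(complex \<Rightarrow> complex) set" where
  "M1 = {f. \<exists>h g (a :: nat \<Rightarrow> complex) (b :: nat \<Rightarrow> complex).
     h holomorphic_on ball 0 1 \<and> g holomorphic_on ball 0 1 \<and>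
     a 0 = 0 \<and> a 1 = 1 \<and> (\<forall>z\<in>ball 0 1. (\<lambda>n. a n * z ^ n) sums h z) \<and>
     b 0 = 0 \<and> (\<forall>z\<in>ball 0 1. (\<lambda>n. b n * z ^ n) sums g z) \<and>
     (\<forall>z\<in>ball 0 1. f z = h z + cnj (g z)) \<and>
     (\<forall>z\<in>ball 0 1. deriv g z = z * deriv h z) \<and>
     (\<forall>z\<in>ball 0 1. deriv h z \<noteq> 0 \<and>
        Re (1 + z * deriv (deriv h) z / deriv h z) > - (1 / 2))}"

text \<open>The library predicate \<^const>\<open>starlike\<close> leaves the centre existentially quantified.\<close>

definition starlike_domain_wrt :: "complex \<Rightarrow> complex set \<Rightarrow> bool" where
  "starlike_domain_wrt c S \<longleftrightarrow>
     open S \<and> connected S \<and> c \<in> S \<and> (\<forall>w\<in>S. closed_segment c w \<subseteq> S)"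

definition radius_of_starlikeness :: "(complex \<Rightarrow> complex) set \<Rightarrow> real" where
  "radius_of_starlikeness F = (GREATEST r0. 0 < r0 \<and> r0 \<le> 1 \<and>
     (\<forall>r. 0 < r \<and> r \<le> r0 \<longrightarrow> (\<forall>f\<in>F. starlike_domain_wrt 0 (f ` ball 0 r))))"

end

theory Submission
  imports Defs
begin

text \<open>
  The lower bound rests on an exact computation for analytic functions. Let \<open>f = h + cnj g\<close> be in
  \<open>M(1)\<close> and put \<open>F = h + \<epsilon> g\<close> for a constant \<open>|\<epsilon>| \<le> 1\<close>, so that \<open>F' = (1 + \<epsilon> z) h'\<close>. The claim is
  \<open>Re (F(a) / (a F'(a))) > 0\<close> for \<open>0 < |a| < 4 sqrt 2 - 5\<close> (\<open>starlike_radius_analytic\<close>).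
  Moving \<open>a\<close> to the origin by a disc automorphism turns the quotient into a positive multiple of
  \<open>\<integral> (1 - x s w) p(s w)\<^sup>3 ds\<close> over \<open>0 \<le> s \<le> 1\<close>, where \<open>w = -a\<close>, \<open>|x| \<le> 1\<close>, and \<open>p\<close> is a cube root of a
  derivative that satisfies the same condition as \<open>h'\<close>: the condition \<open>Re (1 + z h''/h') > -1/2\<close> says
  that \<open>(h')\<close> to the power \<open>2/3\<close> is the derivative of a convex function, and convexity survives disc
  automorphisms (\<open>Koebe_transform_half_plane\<close>). By the theorem of Marx and Strohhaecker \<open>Re p > 1/2\<close>,
  so \<open>p\<close> is an average of kernels \<open>1 / (1 - y z)\<close>; by Feynman's formula a product of three such kernels
  is an average of functions \<open>1 / (1 - y z)\<^sup>3\<close> (\<open>Re_integral_half_plane_cube\<close>). Hence only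
  \<open>p(z)\<^sup>3 = 1 / (1 - y z)\<^sup>3\<close> has to be examined. There the integral is elementary, and its real part is
  positive exactly up to the radius \<open>4 sqrt 2 - 5\<close> (\<open>close_to_convex_kernel_bound\<close>).

  The inequalities for all \<open>\<epsilon>\<close> together give that \<open>arg f\<close> increases along each circle \<open>|z| = r\<close>
  (\<open>Re_harmonic_angular_derivative_pos\<close>). Since \<open>f\<close> is a local diffeomorphism, a preimage of a point
  \<open>w\<close> then moves inwards when \<open>w\<close> moves towards the origin, so every segment from \<open>0\<close> to a point of the
  image of a disc stays in that image (\<open>starlike_image\<close>).

  For the upper bound take \<open>h' = 1 / (1 - z)\<^sup>3\<close>. In the coordinate \<open>\<zeta> = 1 / (1 - z) = X + i Y\<close> this
  function is \<open>(X\<^sup>2 - X - Y\<^sup>2) + i Y\<close>, which is injective for \<open>X > 1/2\<close> with an explicit inverse, and the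
  discs \<open>|z| < r\<close> are discs in the \<open>\<zeta>\<close>-plane. Beyond the stated radius some segment from the origin to
  a boundary point of the image leaves the closed image (\<open>M1_example_not_starlike\<close>).

  The greatest radius in the definition exists, because starlikeness passes to increasing unions of
  images (\<open>radius_of_starlikeness_attained\<close>).
\<close>

section \<open>Logarithmic derivatives and the half plane\<close>

lemma norm_less_norm_one_plus_iff:
  fixes u :: complex
  shows "norm u < norm (1 + u) \<longleftrightarrow> Re u > - 1 / 2"
proof -
  have "norm u < norm (1 + u) \<longleftrightarrow> (norm u)\<^sup>2 < (norm (1 + u))\<^sup>2"
    by (metis norm_ge_zero power2_less_imp_less power_strict_mono pos2)
  also have "\<dots> \<longleftrightarrow> Re u > - 1 / 2"
    unfolding cmod_power2 by (auto simp: power2_eq_square algebra_simps)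
  finally show ?thesis .
qed

text \<open>
  The condition on the real part says that \<open>z L / (1 + z L)\<close> maps the disc into itself, and the Schwarz
  lemma divides by \<open>z\<close>. Unlike the hypothesis, the conclusion is a condition at each point that
  transforms well under disc automorphisms; writing \<open>\<omega> = L / (1 + z L)\<close>, it is the representation
  \<open>L = \<omega> / (1 - z \<omega>)\<close> with \<open>|\<omega>| \<le> 1\<close>.
\<close>

lemma Schwarz_log_derivative:
  assumes holL: "L holomorphic_on ball 0 1"
    and Re_L: "\<And>z. norm z < 1 \<Longrightarrow> Re (z * L z) > - 1 / 2"
    and z: "norm z < 1"
  shows "norm (L z) \<le> norm (1 + z * L z)"
proof -
  define M where "M \<equiv> \<lambda>z. L z / (1 + z * L z)"
  have nz: "1 + z * L z \<noteq> 0" if "norm z < 1" for z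
  proof
    assume "1 + z * L z = 0"
    then have "Re (1 + z * L z) = 0" by simp
    with Re_L[OF that] show False by simp
  qed
  have holM: "M holomorphic_on ball 0 1"
    unfolding M_def by (intro holomorphic_intros holL) (use nz in auto)
  have 1: "(\<lambda>z. z * M z) holomorphic_on ball 0 1"
    by (intro holomorphic_intros holM)
  have 2: "norm (z * M z) < 1" if "norm z < 1" for z
  proof -
    have "norm (z * L z) < norm (1 + z * L z)"
      using Re_L[OF that] norm_less_norm_one_plus_iff by simp
    moreover have "z * M z = (z * L z) / (1 + z * L z)"
      by (simp add: M_def)
    ultimately show ?thesis
      using nz[OF that] by (simp add: norm_divide)
  qed
  have "norm (M z) \<le> 1"
  proof (cases "z = 0")
    case True
    have "(M has_field_derivative deriv M 0) (at 0)"
      using holM by (intro holomorphic_derivI[of _ "ball 0 1"]) auto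
    then have "((\<lambda>z. z * M z) has_field_derivative M 0) (at 0)"
      by (auto intro!: derivative_eq_intros)
    then have "deriv (\<lambda>z. z * M z) 0 = M 0" by (rule DERIV_imp_deriv)
    moreover have "norm (deriv (\<lambda>z. z * M z) 0) \<le> 1"
      by (rule Schwarz_Lemma(2)[OF 1 _ 2 z]) auto
    ultimately show ?thesis using True by simp
  next
    case False
    have "norm (z * M z) \<le> norm z"
      by (rule Schwarz_Lemma(1)[OF 1 _ 2 z]) auto
    then show ?thesis using False by (simp add: norm_mult)
  qed
  then show ?thesis
    using nz[OF z] by (simp add: M_def norm_divide divide_simps)
qed

lemma has_real_derivative_norm_squared:
  fixes w :: "real \<Rightarrow> 'a :: real_inner"
  assumes "(w has_vector_derivative w') (at t)"
  shows "((\<lambda>t. (norm (w t))\<^sup>2) has_real_derivative 2 * inner (w t) w') (at t)"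
proof -
  have "((\<lambda>t. inner (w t) (w t)) has_derivative (\<lambda>h. inner (w t) (h *\<^sub>R w') + inner (h *\<^sub>R w') (w t))) (at t)"
    using assms unfolding has_vector_derivative_def by (intro has_derivative_inner)
  then show ?thesis
    unfolding has_field_derivative_def power2_norm_eq_inner
    by (rule has_derivative_eq_rhs) (auto simp: fun_eq_iff inner_commute)
qed

text \<open>
  The claim is \<open>|\<psi>| < 1\<close> for \<open>\<psi> = 1 - 1 / p\<close>. The proof is Jack's argument: at a point \<open>z\<^sub>0\<close> of smallest
  modulus with \<open>|\<psi>| \<ge> 1\<close> the Schwarz lemma forces \<open>z\<^sub>0 \<psi>'(z\<^sub>0) = \<kappa> \<psi>(z\<^sub>0)\<close> with a real \<open>\<kappa> \<ge> 1\<close>, and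
  then \<open>Re (z\<^sub>0 p'/p) = \<kappa> Re (\<psi> / (1 - \<psi>)) = - \<kappa> / 2\<close>, which the hypothesis excludes.
\<close>

lemma Marx_Strohhaecker:
  assumes holp: "p holomorphic_on ball 0 1"
    and nz: "\<And>z. norm z < 1 \<Longrightarrow> p z \<noteq> 0" and p0: "p 0 = 1"
    and Re_p: "\<And>z. norm z < 1 \<Longrightarrow> Re (z * deriv p z / p z) > - 1 / 2"
    and z: "norm z < 1"
  shows "Re (p z) > 1 / 2"
proof -
  define \<psi> where "\<psi> \<equiv> \<lambda>z. 1 - 1 / p z"
  have hol\<psi>: "\<psi> holomorphic_on ball 0 1"
    unfolding \<psi>_def by (intro holomorphic_intros holp) (use nz in auto)
  have der\<psi>: "(\<psi> has_field_derivative deriv p z / (p z)\<^sup>2) (at z)" if "norm z < 1" for z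
    unfolding \<psi>_def using nz[OF that]
    by (auto intro!: derivative_eq_intros holomorphic_derivI[OF holp] that simp: power2_eq_square)
  have "norm (\<psi> z) < 1"
  proof (rule ccontr)
    assume *: "\<not> norm (\<psi> z) < 1"
    define K where "K = {w \<in> cball 0 (norm z). norm (\<psi> w) \<ge> 1}"
    have "continuous_on (cball 0 (norm z)) \<psi>"
      using hol\<psi> holomorphic_on_imp_continuous_on continuous_on_subset z
      by (metis cball_subset_ball_iff add_0 dist_norm diff_self norm_zero)
    then have "closed K"
      unfolding K_def by (intro continuous_on_closed_Collect_le continuous_intros closed_cball)
    then have "compact K"
      using compact_cball[of "0::complex" "norm z"] unfolding K_def
      by (metis (no_types, lifting) bounded_subset compact_eq_bounded_closed mem_Collect_eq subsetI)
    moreover have "z \<in> K" using * by (auto simp: K_def)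
    moreover have "continuous_on K norm" by (intro continuous_intros)
    ultimately obtain z0 where z0: "z0 \<in> K" and min: "\<And>w. w \<in> K \<Longrightarrow> norm z0 \<le> norm w"
      using continuous_attains_inf[of K norm] by blast
    have z01: "norm z0 < 1" and c1: "norm (\<psi> z0) \<ge> 1" and z0z: "norm z0 \<le> norm z"
      using z0 z by (auto simp: K_def)
    have "\<psi> 0 = 0" by (simp add: \<psi>_def p0)
    then have z0nz: "z0 \<noteq> 0" using c1 by auto
    have less: "norm (\<psi> w) < 1" if "norm w < norm z0" for w
      using min[of w] that z0z by (force simp: K_def)
    have schwarz: "norm (\<psi> (z0 * \<zeta>)) \<le> norm \<zeta>" if "norm \<zeta> < 1" for \<zeta>
    proof (rule Schwarz_Lemma(1)[OF _ _ _ that])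
      have "(\<psi> \<circ> (\<lambda>\<zeta>. z0 * \<zeta>)) holomorphic_on ball 0 1"
        by (rule holomorphic_on_compose_gen[OF _ hol\<psi>])
          (auto intro!: holomorphic_intros simp: norm_mult
            intro: le_less_trans[OF mult_left_le_one_le] z01 mult_le_one less_imp_le
            simp: mult_strict_mono' le_less_trans[OF mult_left_le z01] less_imp_le)
      then show "(\<lambda>\<zeta>. \<psi> (z0 * \<zeta>)) holomorphic_on ball 0 1" by (simp add: o_def)
      show "\<psi> (z0 * 0) = 0" using \<open>\<psi> 0 = 0\<close> by simp
      show "norm (\<psi> (z0 * \<zeta>)) < 1" if "norm \<zeta> < 1" for \<zeta>
        using that z0nz by (intro less) (simp add: norm_mult)
    qed
    have cont0: "isCont \<psi> z0" using der\<psi>[OF z01] DERIV_isCont by blast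
    define c where "c = \<psi> z0"
    have "norm c \<le> 1"
    proof (rule tendsto_upperbound)
      have "((\<lambda>t::real. z0 * of_real t) \<longlongrightarrow> z0 * of_real 1) (at_left 1)"
        by (intro tendsto_intros)
      then show "((\<lambda>t::real. norm (\<psi> (z0 * of_real t))) \<longlongrightarrow> norm c) (at_left 1)"
        unfolding c_def using isCont_tendsto_compose[OF cont0]
        by (intro tendsto_norm) simp
      have "eventually (\<lambda>t::real. t \<in> {0<..<1}) (at_left 1)"
        by (rule eventually_at_leftI) auto
      then show "eventually (\<lambda>t::real. norm (\<psi> (z0 * of_real t)) \<le> 1) (at_left 1)"
        by eventually_elim (rule order_trans[OF schwarz], auto)
    qed auto
    with c1 have nc: "norm c = 1" by (simp add: c_def)
    have Re_inner: "Re (cnj c * w) = inner c w" for w by (simp add: inner_complex_def)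
    define \<kappa> where "\<kappa> = z0 * (deriv p z0 / (p z0)\<^sup>2) * cnj c"
    \<comment> \<open>In every direction \<open>v\<close> that points into the unit disc at \<open>1\<close>, the difference
      \<open>|\<zeta>|\<^sup>2 - |\<psi>(z\<^sub>0 \<zeta>)|\<^sup>2\<close> vanishes at \<open>1\<close> and cannot decrease; letting \<open>v\<close> vary over a half plane pins
      down \<open>\<kappa>\<close>.\<close>
    have key: "Re ((\<kappa> - 1) * v) \<le> 0" if v: "Re v < 0" for v
    proof (rule ccontr)
      assume neg: "\<not> Re ((\<kappa> - 1) * v) \<le> 0"
      define G where "G \<equiv> \<lambda>t::real. (norm (1 + of_real t * v))\<^sup>2 - (norm (\<psi> (z0 * (1 + of_real t * v))))\<^sup>2"
      have d1: "((\<lambda>t::real. 1 + of_real t * v) has_vector_derivative v) (at 0)"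
        by (auto intro!: derivative_eq_intros simp: has_vector_derivative_def scaleR_conv_of_real)
      have d2: "((\<lambda>t::real. \<psi> (z0 * (1 + of_real t * v))) has_vector_derivative
                 z0 * v * (deriv p z0 / (p z0)\<^sup>2)) (at 0)"
      proof -
        have "((\<lambda>t::real. z0 * (1 + of_real t * v)) has_vector_derivative z0 * v) (at 0)"
          by (auto intro!: derivative_eq_intros simp: has_vector_derivative_def scaleR_conv_of_real)
        from field_vector_diff_chain_at[OF this, of \<psi> "deriv p z0 / (p z0)\<^sup>2"] der\<psi>[OF z01]
        show ?thesis by (simp add: o_def)
      qed
      have "(G has_real_derivative 2 * inner 1 v - 2 * inner c (z0 * v * (deriv p z0 / (p z0)\<^sup>2))) (at 0)"
        unfolding G_def
        using DERIV_diff[OF has_real_derivative_norm_squared[OF d1] has_real_derivative_norm_squared[OF d2]]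
        by (simp add: c_def)
      moreover have "inner 1 v - inner c (z0 * v * (deriv p z0 / (p z0)\<^sup>2)) = - Re ((\<kappa> - 1) * v)"
      proof -
        have "Re (\<kappa> * v) = Re (cnj c * (z0 * v * (deriv p z0 / (p z0)\<^sup>2)))"
          by (simp add: \<kappa>_def mult_ac)
        also have "\<dots> = inner c (z0 * v * (deriv p z0 / (p z0)\<^sup>2))"
          by (rule Re_inner)
        finally show ?thesis by (simp add: algebra_simps inner_complex_def)
      qed
      ultimately have "(G has_real_derivative - 2 * Re ((\<kappa> - 1) * v)) (at 0)" by (simp add: algebra_simps)
      then obtain d where d: "d > 0" "\<And>h. 0 < h \<Longrightarrow> h < d \<Longrightarrow> G (0 + h) < G 0"
        using DERIV_neg_dec_right[of G _ 0] neg by force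
      have "((\<lambda>t::real. (norm (1 + of_real t * v))\<^sup>2) has_real_derivative 2 * Re v) (at 0)"
        using has_real_derivative_norm_squared[OF d1] by simp
      then obtain d' where d': "d' > 0" "\<And>h. 0 < h \<Longrightarrow> h < d' \<Longrightarrow> (norm (1 + of_real (0 + h) * v))\<^sup>2 < 1"
        using DERIV_neg_dec_right[of "\<lambda>t::real. (norm (1 + of_real t * v))\<^sup>2" _ 0] v by force
      define h where "h = min d d' / 2"
      have h: "0 < h" "h < d" "h < d'" using d(1) d'(1) by (auto simp: h_def)
      have "G 0 = 0" using nc by (simp add: G_def c_def)
      then have "G h < 0" using d(2)[of h] h by simp
      moreover have "norm (\<psi> (z0 * (1 + of_real h * v))) \<le> norm (1 + of_real h * v)"
        using d'(2)[of h] h by (intro schwarz) (simp add: abs_square_less_1)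
      then have "G h \<ge> 0" unfolding G_def by (simp add: power_mono)
      ultimately show False by simp
    qed
    have "Re (\<kappa> - 1) \<ge> 0"
      using key[of "-1"] by simp
    have "Im \<kappa> = 0"
    proof (rule ccontr)
      assume nz: "Im \<kappa> \<noteq> 0"
      \<comment> \<open>This slope makes \<open>Re ((\<kappa> - 1) v) = 1\<close> for \<open>v = -1 + i y\<close>.\<close>
      define y where "y = - (1 + Re (\<kappa> - 1)) / Im \<kappa>"
      have "Re ((\<kappa> - 1) * Complex (-1) y) = - Re (\<kappa> - 1) - Im \<kappa> * y"
        by simp
      also have "\<dots> = 1" using nz by (simp add: y_def)
      finally show False using key[of "Complex (-1) y"] by simp
    qed
    have pz: "p z0 = 1 / (1 - c)" "c \<noteq> 1"
      using nz[OF z01] by (auto simp: c_def \<psi>_def)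
    have cc: "cnj c * c = 1" using nc by (metis complex_norm_square mult.commute of_real_1 power_one)
    have "z0 * deriv p z0 / p z0 = (\<kappa> * c) * p z0"
      using cc nz[OF z01] by (simp add: \<kappa>_def power2_eq_square field_simps)
    also have "\<dots> = of_real (Re \<kappa>) * (c / (1 - c))"
      using complex_is_Real_iff[of \<kappa>] \<open>Im \<kappa> = 0\<close> by (simp add: pz)
    finally have "Re (z0 * deriv p z0 / p z0) = Re \<kappa> * Re (c / (1 - c))"
      by (simp only: scaleR_conv_of_real[symmetric] scaleR_complex.sel)
    moreover have "Re (c / (1 - c)) = - 1 / 2"
    proof -
      have n: "(Re c)\<^sup>2 + (Im c)\<^sup>2 = 1" using nc by (metis cmod_power2 power_one)
      then have "Re c \<noteq> 1" using pz(2) by (auto simp: complex_eq_iff)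
      have "(1 - Re c)\<^sup>2 + (Im c)\<^sup>2 = 2 * (1 - Re c)" using n by (simp add: power2_eq_square algebra_simps)
      moreover have "Re c * (1 - Re c) - Im c * Im c = -(1 - Re c)"
        using n by (simp add: power2_eq_square algebra_simps)
      ultimately show ?thesis
        using \<open>Re c \<noteq> 1\<close> by (simp add: Re_divide divide_simps)
    qed
    ultimately show False
      using Re_p[OF z01] \<open>Re (\<kappa> - 1) \<ge> 0\<close> by simp
  qed
  then have "norm (p z - 1) < norm (1 + (p z - 1))"
  proof -
    have "p z - 1 = \<psi> z * p z" using nz[OF z] by (simp add: \<psi>_def field_simps)
    then have "norm (p z - 1) = norm (\<psi> z) * norm (p z)" by (simp add: norm_mult)
    also have "\<dots> < norm (p z)" using \<open>norm (\<psi> z) < 1\<close> nz[OF z] by simp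
    finally show ?thesis by simp
  qed
  then show ?thesis using norm_less_norm_one_plus_iff[of "p z - 1"] by simp
qed

section \<open>Averages over rational kernels\<close>

text \<open>
  A lower bound for \<open>Re \<integral> f K\<^sub>t\<close> that is uniform in \<open>t\<close> passes to weighted averages of the kernels \<open>K\<^sub>t\<close>,
  by Fubini. All reductions to simpler kernels below are instances.
\<close>

lemma Re_integral_average:
  fixes f :: "real \<Rightarrow> complex" and K :: "real \<Rightarrow> real \<Rightarrow> complex" and m :: "real \<Rightarrow> real"
  assumes contf: "continuous_on {0..1} f" and contm: "continuous_on {0..1} m"
    and contK: "continuous_on ({0..1} \<times> {0..1}) (\<lambda>(t, s). K t s)"
    and m_nonneg: "\<And>t. t \<in> {0..1} \<Longrightarrow> 0 \<le> m t" and m1: "(m has_integral 1) {0..1}"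
    and bound: "\<And>t. t \<in> {0..1} \<Longrightarrow> \<delta> \<le> Re (integral {0..1} (\<lambda>s. f s * K t s))"
  shows "\<delta> \<le> Re (integral {0..1} (\<lambda>s. f s * integral {0..1} (\<lambda>t. of_real (m t) * K t s)))"
proof -
  have contK': "continuous_on ({0..1} \<times> {0..1}) (\<lambda>(t, s). f s * K t s)"
    unfolding case_prod_beta
    by (intro continuous_intros continuous_on_compose2[OF contf] contK[unfolded case_prod_beta]) auto
  have cont: "continuous_on ({0..1} \<times> {0..1}) (\<lambda>(t, s). f s * (of_real (m t) * K t s))"
    unfolding case_prod_beta
    by (intro continuous_intros continuous_on_compose2[OF contf] continuous_on_compose2[OF contm]
        contK[unfolded case_prod_beta]) auto
  define J where "J \<equiv> \<lambda>t. integral {0..1} (\<lambda>s. f s * K t s)"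
  have contJ: "continuous_on {0..1} J"
    unfolding J_def using integral_continuous_on_param[of "{0..1}" "0::real" 1 "\<lambda>t s. f s * K t s"] contK'
    by simp
  have "integral {0..1} (\<lambda>s. f s * integral {0..1} (\<lambda>t. of_real (m t) * K t s))
      = integral {0..1} (\<lambda>s. integral {0..1} (\<lambda>t. f s * (of_real (m t) * K t s)))"
    by simp
  also have "\<dots> = integral {0..1} (\<lambda>t. integral {0..1} (\<lambda>s. f s * (of_real (m t) * K t s)))"
    using integral_swap_continuous[of 0 0 1 1 "\<lambda>t s. f s * (of_real (m t) * K t s)"] cont
    by (simp add: cbox_Pair_eq)
  also have "\<dots> = integral {0..1} (\<lambda>t. of_real (m t) * J t)"
    unfolding J_def integral_mult_right[symmetric] by (simp add: mult_ac)
  finally have eq: "integral {0..1} (\<lambda>s. f s * integral {0..1} (\<lambda>t. of_real (m t) * K t s))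
      = integral {0..1} (\<lambda>t. of_real (m t) * J t)" .
  have int: "(\<lambda>t. of_real (m t) * J t) integrable_on {0..1}"
    by (intro integrable_continuous_real continuous_intros contJ contm)
  have "((\<lambda>t. Re (of_real (m t) * J t)) has_integral Re (integral {0..1} (\<lambda>t. of_real (m t) * J t))) {0..1}"
    using has_integral_linear[OF integrable_integral[OF int] bounded_linear_Re] by (simp add: o_def)
  moreover have "((\<lambda>t. m t * \<delta>) has_integral \<delta>) {0..1}"
    using has_integral_mult_left[OF m1, of \<delta>] by simp
  ultimately have "\<delta> \<le> Re (integral {0..1} (\<lambda>t. of_real (m t) * J t))"
    using m_nonneg bound
    by (elim has_integral_le[rotated]) (auto simp: J_def intro!: mult_left_mono)
  then show ?thesis unfolding eq .
qed

text \<open>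
  Cauchy's formula with the circle parametrised by \<open>[0, 1]\<close>, so that it reads as an average.
\<close>

lemma Cauchy_integral_circle_average:
  assumes holG: "G holomorphic_on cball 0 R" and R: "0 < R" and z: "norm z < R"
  shows "((\<lambda>t. G (of_real R * cis (2 * pi * t)) *
           (of_real R * cis (2 * pi * t) / (of_real R * cis (2 * pi * t) - z))) has_integral G z) {0..1}"
proof -
  have "((\<lambda>u. G u / (u - z)) has_contour_integral (2 * of_real pi * \<i>) * G z) (circlepath 0 R)"
    using z by (intro Cauchy_integral_circlepath_simple holG) auto
  then have "((\<lambda>t. G (circlepath 0 R t) / (circlepath 0 R t - z) * (2 * pi * \<i> * R * exp (2 * of_real pi * \<i> * t)))
     has_integral (2 * of_real pi * \<i>) * G z) {0..1}"
    unfolding has_contour_integral vector_derivative_circlepath by simp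
  then have "((\<lambda>t. 1 / (2 * of_real pi * \<i>) * (G (circlepath 0 R t) / (circlepath 0 R t - z) * (2 * pi * \<i> * R * exp (2 * of_real pi * \<i> * t))))
     has_integral 1 / (2 * of_real pi * \<i>) * ((2 * of_real pi * \<i>) * G z)) {0..1}"
    by (rule has_integral_mult_right)
  then show ?thesis
    by (rule has_integral_eq_rhs[OF has_integral_eq, rotated])
      (auto simp: circlepath cis_conv_exp mult_ac)
qed

text \<open>
  Cauchy's formula applied to \<open>p\<close> gives the part of the integral with \<open>p(\<xi>)\<close>. On the circle the
  conjugate of \<open>\<xi> / (\<xi> - z)\<close> equals \<open>R\<^sup>2 / (R\<^sup>2 - cnj z \<xi>)\<close>, which is analytic in the disc, so the part
  with the conjugate of \<open>p(\<xi>)\<close> only contributes \<open>p 0 = 1\<close>.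
\<close>

lemma Herglotz_circle:
  assumes holp: "p holomorphic_on ball 0 1" and p0: "p 0 = 1"
    and R: "0 < R" "R < 1" and z: "norm z < R"
  defines "\<xi> \<equiv> \<lambda>t. of_real R * cis (2 * pi * t)"
  shows "((\<lambda>t. of_real (2 * Re (p (\<xi> t)) - 1) * (\<xi> t / (\<xi> t - z))) has_integral p z) {0..1}"
proof -
  have holp': "p holomorphic_on cball 0 R"
    using holp by (rule holomorphic_on_subset) (use R in auto)
  have n\<xi>: "norm (\<xi> t) = R" for t
    using R by (simp add: \<xi>_def norm_mult)
  have \<xi>: "\<xi> t * cnj (\<xi> t) = of_real (R\<^sup>2)" "norm (\<xi> t) = R" "\<xi> t \<noteq> 0" for t
    using R n\<xi>[of t] complex_norm_square[of "\<xi> t"] by auto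
  have 1: "((\<lambda>t. p (\<xi> t) * (\<xi> t / (\<xi> t - z))) has_integral p z) {0..1}"
    unfolding \<xi>_def by (rule Cauchy_integral_circle_average[OF holp' R(1) z])
  have 2: "((\<lambda>t. \<xi> t / (\<xi> t - z)) has_integral 1) {0..1}"
    unfolding \<xi>_def using Cauchy_integral_circle_average[OF _ R(1) z, of "\<lambda>_. 1"] by simp
  have nz: "of_real (R\<^sup>2) - cnj z * u \<noteq> 0" if "norm u \<le> R" for u
  proof -
    have "norm (cnj z * u) < R * R"
      using z that R unfolding norm_mult
      by (metis complex_mod_cnj less_le_trans mult_left_mono mult_strict_right_mono norm_ge_zero
          order.strict_trans1 zero_less_norm_iff mult_zero_right norm_zero mult_pos_pos less_eq_real_def)
    moreover have "norm (of_real (R\<^sup>2) :: complex) = R * R"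
      using R by (simp add: power2_eq_square norm_mult)
    ultimately show ?thesis by (metis eq_iff_diff_eq_0 less_irrefl)
  qed
  have "(\<lambda>u. p u * (of_real (R\<^sup>2) / (of_real (R\<^sup>2) - cnj z * u))) holomorphic_on cball 0 R"
    by (intro holomorphic_intros holp') (use nz in auto)
  from Cauchy_integral_circle_average[OF this R(1), of 0]
  have "((\<lambda>t. p (\<xi> t) * (of_real (R\<^sup>2) / (of_real (R\<^sup>2) - cnj z * \<xi> t))) has_integral 1) {0..1}"
    using R by (simp add: p0 \<xi>_def)
  then have "((\<lambda>t. p (\<xi> t) * cnj (\<xi> t / (\<xi> t - z))) has_integral 1) {0..1}"
  proof (rule has_integral_eq[rotated])
    fix t
    have "cnj (\<xi> t) - cnj z \<noteq> 0"
      using z \<xi>(2)[of t] by (metis complex_cnj_cancel_iff eq_iff_diff_eq_0 less_irrefl)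
    then show "p (\<xi> t) * (of_real (R\<^sup>2) / (of_real (R\<^sup>2) - cnj z * \<xi> t)) = p (\<xi> t) * cnj (\<xi> t / (\<xi> t - z))"
      using \<xi>(3)[of t] unfolding \<xi>(1)[of t, symmetric] by (simp add: divide_simps) (simp add: algebra_simps)
  qed
  from has_integral_linear[OF this bounded_linear_cnj]
  have 3: "((\<lambda>t. cnj (p (\<xi> t)) * (\<xi> t / (\<xi> t - z))) has_integral 1) {0..1}"
    by (simp add: o_def)
  have "((\<lambda>t. p (\<xi> t) * (\<xi> t / (\<xi> t - z)) + cnj (p (\<xi> t)) * (\<xi> t / (\<xi> t - z)) - \<xi> t / (\<xi> t - z))
     has_integral p z + 1 - 1) {0..1}"
    by (intro has_integral_diff has_integral_add 1 2 3)
  then show ?thesis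
  proof (rule has_integral_eq_rhs[OF has_integral_eq, rotated])
    fix t
    have "of_real (2 * Re (p (\<xi> t)) - 1) = p (\<xi> t) + cnj (p (\<xi> t)) - 1"
      by (simp add: complex_add_cnj)
    then show "p (\<xi> t) * (\<xi> t / (\<xi> t - z)) + cnj (p (\<xi> t)) * (\<xi> t / (\<xi> t - z)) - \<xi> t / (\<xi> t - z)
      = of_real (2 * Re (p (\<xi> t)) - 1) * (\<xi> t / (\<xi> t - z))"
      by (simp only:) (simp add: algebra_simps)
  qed simp
qed

lemma one_minus_nonzero:
  fixes \<kappa> :: complex
  assumes "norm \<kappa> < 1" "0 \<le> s" "s \<le> 1"
  shows "1 - \<kappa> * of_real s \<noteq> 0"
proof -
  have "norm (\<kappa> * of_real s) < 1"
    using assms by (metis (no_types, opaque_lifting) abs_of_nonneg le_less_trans mult_left_le norm_ge_zero norm_mult norm_of_real)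
  then show ?thesis by (metis eq_iff_diff_eq_0 less_irrefl norm_one)
qed

text \<open>
  The Herglotz formula exhibits \<open>z \<mapsto> p(z)\<close> as an average of the kernels \<open>\<xi> / (\<xi> - z)\<close> with the
  nonnegative weights \<open>2 Re p(\<xi>) - 1\<close>. The bound is required for \<open>|\<kappa>| \<le> r\<close> with \<open>r\<close> strictly above
  \<open>|w|\<close>: this leaves room for a circle of radius \<open>|w| / r < 1\<close> inside the domain of \<open>p\<close>, on which
  \<open>\<xi> / (\<xi> - s w) = 1 / (1 - \<kappa> s)\<close> with \<open>\<kappa> = w / \<xi>\<close> of modulus exactly \<open>r\<close>.
\<close>

lemma Re_integral_half_plane_mult:
  assumes holp: "p holomorphic_on ball 0 1" and p0: "p 0 = 1"
    and Re_p: "\<And>z. norm z < 1 \<Longrightarrow> Re (p z) > 1 / 2"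
    and w: "w \<noteq> 0" "norm w < r" and r: "r < 1"
    and contf: "continuous_on {0..1} f"
    and bound: "\<And>\<kappa>. norm \<kappa> \<le> r \<Longrightarrow> \<delta> \<le> Re (integral {0..1} (\<lambda>s. f s * (1 / (1 - \<kappa> * of_real s))))"
  shows "\<delta> \<le> Re (integral {0..1} (\<lambda>s. f s * p (of_real s * w)))"
proof -
  define R where "R = norm w / r"
  have r0: "0 < r" using w(2) norm_ge_zero[of w] by linarith
  have R: "0 < R" "R < 1" using w r0 by (auto simp: R_def)
  have wR: "norm w < R" using w r r0 by (auto simp: R_def field_simps)
  define \<xi> where "\<xi> \<equiv> \<lambda>t. of_real R * cis (2 * pi * t)"
  have n\<xi>: "norm (\<xi> t) = R" "\<xi> t \<noteq> 0" for t using R by (auto simp: \<xi>_def norm_mult)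
  have n\<kappa>: "norm (w / \<xi> t) = r" for t
    using r0 w by (simp add: norm_divide n\<xi> R_def)
  define m where "m \<equiv> \<lambda>t. 2 * Re (p (\<xi> t)) - 1"
  define K where "K \<equiv> \<lambda>t s. 1 / (1 - (w / \<xi> t) * of_real s)"
  have cont\<xi>: "continuous_on A \<xi>" for A
    unfolding \<xi>_def cis_conv_exp by (intro continuous_intros)
  have contp: "continuous_on (ball 0 1) p"
    using holp by (rule holomorphic_on_imp_continuous_on)
  have K_eq: "K t s = \<xi> t / (\<xi> t - of_real s * w)" for t s
    using n\<xi>(2)[of t] by (simp add: K_def field_simps)
  have herglotz: "((\<lambda>t. of_real (m t) * (\<xi> t / (\<xi> t - z))) has_integral p z) {0..1}" if "norm z < R" for z
    using Herglotz_circle[OF holp p0 R that] by (simp add: m_def \<xi>_def)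
  have "\<delta> \<le> Re (integral {0..1} (\<lambda>s. f s * integral {0..1} (\<lambda>t. of_real (m t) * K t s)))"
  proof (rule Re_integral_average[OF contf])
    show "continuous_on {0..1} m"
      unfolding m_def
      by (intro continuous_intros continuous_on_compose2[OF contp] cont\<xi>) (use R n\<xi> in auto)
    have "1 - w / \<xi> t * of_real s \<noteq> 0" if "0 \<le> s" "s \<le> 1" for t s
      using n\<kappa>[of t] r that by (intro one_minus_nonzero) auto
    then show "continuous_on ({0..1} \<times> {0..1}) (\<lambda>(t, s). K t s)"
      unfolding K_def case_prod_beta
      by (intro continuous_intros continuous_on_compose2[OF cont\<xi>[of UNIV]])
        (use n\<xi>(2) in \<open>auto simp del: right_minus_eq\<close>)
    show "0 \<le> m t" for t
      using Re_p[of "\<xi> t"] R n\<xi> by (simp add: m_def)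
    have "((\<lambda>t. Re (of_real (m t) * (\<xi> t / (\<xi> t - 0)))) has_integral Re (p 0)) {0..1}"
      using has_integral_linear[OF herglotz[of 0] bounded_linear_Re] R by (simp add: o_def)
    then show "(m has_integral 1) {0..1}"
      using n\<xi>(2) by (simp add: p0)
    show "\<delta> \<le> Re (integral {0..1} (\<lambda>s. f s * K t s))" for t
      unfolding K_def using bound[of "w / \<xi> t"] n\<kappa> by simp
  qed
  also have "integral {0..1} (\<lambda>s. f s * integral {0..1} (\<lambda>t. of_real (m t) * K t s))
     = integral {0..1} (\<lambda>s. f s * p (of_real s * w))"
  proof (rule integral_cong)
    fix s :: real assume s: "s \<in> {0..1}"
    have "norm (of_real s * w) \<le> norm w" using s by (simp add: norm_mult mult_left_le_one_le)
    then have "norm (of_real s * w) < R" using wR by linarith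
    from integral_unique[OF herglotz[OF this]]
    show "f s * integral {0..1} (\<lambda>t. of_real (m t) * K t s) = f s * p (of_real s * w)"
      by (simp add: K_eq)
  qed
  finally show ?thesis .
qed

lemma convex_combination_norm_le:
  fixes \<kappa> \<mu> :: complex
  assumes "norm \<kappa> \<le> r" "norm \<mu> \<le> r" "0 \<le> t" "t \<le> 1"
  shows "norm (of_real t * \<kappa> + of_real (1 - t) * \<mu>) \<le> r"
proof -
  have "t *\<^sub>R \<kappa> + (1 - t) *\<^sub>R \<mu> \<in> cball 0 r"
    using assms by (intro convexD[OF convex_cball]) auto
  then show ?thesis by (simp add: scaleR_conv_of_real)
qed

text \<open>
  Feynman's formulas write a reciprocal of a product as an average of reciprocal powers of convex
  combinations of the factors.
\<close>

lemma Feynman_2: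
  fixes A B :: complex
  assumes nz: "\<And>t. 0 \<le> t \<Longrightarrow> t \<le> 1 \<Longrightarrow> of_real t * A + of_real (1 - t) * B \<noteq> 0"
  shows "((\<lambda>t. 1 / (of_real t * A + of_real (1 - t) * B)^2) has_integral 1 / (A * B)) {0..1}"
proof -
  have AB: "A \<noteq> 0" "B \<noteq> 0" using nz[of 1] nz[of 0] by auto
  define F where "F \<equiv> \<lambda>t::complex. t / (B * (t * A + (1 - t) * B))"
  have "((\<lambda>t::real. F (of_real t)) has_vector_derivative 1 / (of_real t * A + of_real (1 - t) * B)^2) (at t within {0..1})"
    if "t \<in> {0..1}" for t
  proof -
    have "(F has_field_derivative 1 / (of_real t * A + of_real (1 - t) * B)^2) (at (of_real t))"
      unfolding F_def using nz[of t] that AB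
      by (auto intro!: derivative_eq_intros simp: divide_simps power2_eq_square) (simp_all add: algebra_simps)
    then show ?thesis by (rule has_vector_derivative_real_field[OF has_field_derivative_at_within])
  qed
  from fundamental_theorem_of_calculus[OF _ this]
  show ?thesis using AB by (simp add: F_def mult.commute)
qed

lemma Feynman_3:
  fixes A B :: complex
  assumes nz: "\<And>t. 0 \<le> t \<Longrightarrow> t \<le> 1 \<Longrightarrow> of_real t * A + of_real (1 - t) * B \<noteq> 0"
  shows "((\<lambda>t. of_real (2 * t) * (1 / (of_real t * A + of_real (1 - t) * B)^3)) has_integral 1 / (A^2 * B)) {0..1}"
proof -
  have AB: "A \<noteq> 0" "B \<noteq> 0" using nz[of 1] nz[of 0] by auto
  define F where "F \<equiv> \<lambda>t::complex. t^2 / (B * (t * A + (1 - t) * B)^2)"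
  have "((\<lambda>t::real. F (of_real t)) has_vector_derivative of_real (2 * t) * (1 / (of_real t * A + of_real (1 - t) * B)^3)) (at t within {0..1})"
    if "t \<in> {0..1}" for t
  proof -
    have "(F has_field_derivative of_real (2 * t) * (1 / (of_real t * A + of_real (1 - t) * B)^3)) (at (of_real t))"
      unfolding F_def using nz[of t] that AB
      apply (auto intro!: derivative_eq_intros simp: divide_simps power2_eq_square power3_eq_cube) 
      apply (simp_all add: algebra_simps)
      done
    then show ?thesis by (rule has_vector_derivative_real_field[OF has_field_derivative_at_within])
  qed
  from fundamental_theorem_of_calculus[OF _ this]
  show ?thesis using AB by (simp add: F_def mult.commute)
qed

text \<open>
  Two applications of Feynman's formulas. The set of admissible \<open>\<kappa>\<close> is a disc, hence convex, so the
  convex combinations of factors \<open>1 - \<kappa> s\<close> are again factors of the same kind.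
\<close>

lemma Re_integral_three_factors:
  fixes f :: "real \<Rightarrow> complex"
  assumes contf: "continuous_on {0..1} f" and r: "r < 1"
    and bound: "\<And>\<kappa>. norm \<kappa> \<le> r \<Longrightarrow> \<delta> \<le> Re (integral {0..1} (\<lambda>s. f s * (1 / (1 - \<kappa> * of_real s) ^ 3)))"
    and \<kappa>: "norm \<kappa>1 \<le> r" "norm \<kappa>2 \<le> r" "norm \<kappa>3 \<le> r"
  shows "\<delta> \<le> Re (integral {0..1} (\<lambda>s. f s * (1 / (1 - \<kappa>1 * of_real s)) * (1 / (1 - \<kappa>2 * of_real s)) *
            (1 / (1 - \<kappa>3 * of_real s))))"
proof -
  have nz: "1 - \<kappa> * of_real s \<noteq> 0" if "norm \<kappa> \<le> r" "s \<in> {0..1}" for \<kappa> :: complex and s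
    using that r by (intro one_minus_nonzero) auto
  have comb: "1 - (of_real t * \<kappa> + of_real (1 - t) * \<mu>) * of_real s =
      of_real t * (1 - \<kappa> * of_real s) + of_real (1 - t) * (1 - \<mu> * of_real s)" for t s and \<kappa> \<mu> :: complex
    by (simp add: algebra_simps)
  have nz_comb: "of_real t * (1 - \<kappa> * of_real s) + of_real (1 - t) * (1 - \<mu> * of_real s) \<noteq> 0"
    if "norm \<kappa> \<le> r" "norm \<mu> \<le> r" "0 \<le> t" "t \<le> 1" "s \<in> {0..1}" for t s and \<kappa> \<mu> :: complex
    using nz[OF convex_combination_norm_le[OF that(1-4)] that(5)] unfolding comb .
  have two: "\<delta> \<le> Re (integral {0..1} (\<lambda>s. f s * (1 / ((1 - \<kappa> * of_real s)\<^sup>2 * (1 - \<mu> * of_real s)))))"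
    if n: "norm \<kappa> \<le> r" "norm \<mu> \<le> r" for \<kappa> \<mu>
  proof -
    define K where "K \<equiv> \<lambda>t s. 1 / (1 - (of_real t * \<kappa> + of_real (1 - t) * \<mu>) * of_real s) ^ 3"
    have "\<delta> \<le> Re (integral {0..1} (\<lambda>s. f s * integral {0..1} (\<lambda>t. of_real (2 * t) * K t s)))"
    proof (rule Re_integral_average[OF contf])
      show "continuous_on ({0..1} \<times> {0..1}) (\<lambda>(t, s). K t s)"
        unfolding K_def case_prod_beta
        by (intro continuous_intros ballI) (use nz[OF convex_combination_norm_le[OF n]] in \<open>auto simp del: right_minus_eq\<close>)
      have "((\<lambda>t::real. 2 * t) has_integral 1\<^sup>2 - 0\<^sup>2) {0..1}"
        by (rule fundamental_theorem_of_calculus)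
          (auto intro!: derivative_eq_intros simp flip: has_real_derivative_iff_has_vector_derivative)
      then show "((\<lambda>t::real. 2 * t) has_integral 1) {0..1}" by simp
      show "\<delta> \<le> Re (integral {0..1} (\<lambda>s. f s * K t s))" if "t \<in> {0..1}" for t
        unfolding K_def using that by (intro bound convex_combination_norm_le[OF n]) auto
    qed (auto intro: continuous_intros)
    also have "integral {0..1} (\<lambda>s. f s * integral {0..1} (\<lambda>t. of_real (2 * t) * K t s))
       = integral {0..1} (\<lambda>s. f s * (1 / ((1 - \<kappa> * of_real s)\<^sup>2 * (1 - \<mu> * of_real s))))"
    proof (rule integral_cong)
      fix s :: real assume s: "s \<in> {0..1}"
      show "f s * integral {0..1} (\<lambda>t. of_real (2 * t) * K t s) = f s * (1 / ((1 - \<kappa> * of_real s)\<^sup>2 * (1 - \<mu> * of_real s)))"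
        unfolding K_def comb using integral_unique[OF Feynman_3[OF nz_comb[OF n _ _ s]]] by simp
    qed
    finally show ?thesis .
  qed
  define g where "g \<equiv> \<lambda>s. f s * (1 / (1 - \<kappa>3 * of_real s))"
  define K where "K \<equiv> \<lambda>t s. 1 / (1 - (of_real t * \<kappa>1 + of_real (1 - t) * \<kappa>2) * of_real s) ^ 2"
  have "\<delta> \<le> Re (integral {0..1} (\<lambda>s. g s * integral {0..1} (\<lambda>t. of_real 1 * K t s)))"
  proof (rule Re_integral_average)
    show "continuous_on {0..1} g"
      unfolding g_def by (intro continuous_intros contf) (use nz \<kappa>(3) in auto)
    show "continuous_on ({0..1} \<times> {0..1}) (\<lambda>(t, s). K t s)"
      unfolding K_def case_prod_beta
      by (intro continuous_intros ballI) (use nz[OF convex_combination_norm_le[OF \<kappa>(1,2)]] in \<open>auto simp del: right_minus_eq\<close>)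
    show "((\<lambda>t::real. 1::real) has_integral 1) {0..1}"
      using has_integral_const_real[of "1::real" 0 1] by simp
    show "\<delta> \<le> Re (integral {0..1} (\<lambda>s. g s * K t s))" if "t \<in> {0..1}" for t
      using two[OF convex_combination_norm_le[OF \<kappa>(1,2), of t] \<kappa>(3)] that
      by (simp add: g_def K_def mult_ac)
  qed auto
  also have "integral {0..1} (\<lambda>s. g s * integral {0..1} (\<lambda>t. of_real 1 * K t s))
     = integral {0..1} (\<lambda>s. f s * (1 / (1 - \<kappa>1 * of_real s)) * (1 / (1 - \<kappa>2 * of_real s)) *
            (1 / (1 - \<kappa>3 * of_real s)))"
  proof (rule integral_cong)
    fix s :: real assume s: "s \<in> {0..1}"
    show "g s * integral {0..1} (\<lambda>t. of_real 1 * K t s) = f s * (1 / (1 - \<kappa>1 * of_real s)) * (1 / (1 - \<kappa>2 * of_real s)) *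
            (1 / (1 - \<kappa>3 * of_real s))"
      unfolding K_def comb using integral_unique[OF Feynman_2[OF nz_comb[OF \<kappa>(1,2) _ _ s]]] by (simp add: g_def)
  qed
  finally show ?thesis .
qed

text \<open>
  The three factors \<open>1 / (1 - \<kappa>\<^sub>i s)\<close> are replaced by \<open>p\<close> one at a time; at each step the remaining
  factors belong to the function in front of the kernel.
\<close>

lemma Re_integral_half_plane_cube:
  assumes holp: "p holomorphic_on ball 0 1" and p0: "p 0 = 1"
    and Re_p: "\<And>z. norm z < 1 \<Longrightarrow> Re (p z) > 1 / 2"
    and w: "w \<noteq> 0" "norm w < r" and r: "r < 1"
    and contf: "continuous_on {0..1} f"
    and bound: "\<And>\<kappa>. norm \<kappa> \<le> r \<Longrightarrow> \<delta> \<le> Re (integral {0..1} (\<lambda>s. f s * (1 / (1 - \<kappa> * of_real s) ^ 3)))"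
  shows "\<delta> \<le> Re (integral {0..1} (\<lambda>s. f s * p (of_real s * w) ^ 3))"
proof -
  have nz: "1 - \<kappa> * of_real s \<noteq> 0" if "norm \<kappa> \<le> r" "s \<in> {0..1}" for \<kappa> :: complex and s
    using that r by (intro one_minus_nonzero) auto
  have "norm (of_real s * w) < 1" if "s \<in> {0..1}" for s
  proof -
    have "norm (of_real s * w) \<le> norm w" using that by (simp add: norm_mult mult_left_le_one_le)
    then show ?thesis using w r by linarith
  qed
  then have contp: "continuous_on {0..1} (\<lambda>s. p (of_real s * w))"
    by (intro continuous_on_compose2[OF holomorphic_on_imp_continuous_on[OF holp]] continuous_intros) auto
  have contk: "continuous_on {0..1} (\<lambda>s. 1 / (1 - \<kappa> * of_real s))" if "norm \<kappa> \<le> r" for \<kappa> :: complex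
    by (intro continuous_intros) (use nz that in auto)
  note step = Re_integral_half_plane_mult[OF holp p0 Re_p w r]
  have 1: "\<delta> \<le> Re (integral {0..1} (\<lambda>s. f s * (1 / (1 - \<kappa>1 * of_real s)) * (1 / (1 - \<kappa>2 * of_real s)) * p (of_real s * w)))"
    if n: "norm \<kappa>1 \<le> r" "norm \<kappa>2 \<le> r" for \<kappa>1 \<kappa>2
    by (intro step continuous_intros contf contk n Re_integral_three_factors[OF contf r bound])
  have 2: "\<delta> \<le> Re (integral {0..1} (\<lambda>s. f s * (1 / (1 - \<kappa> * of_real s)) * p (of_real s * w) * p (of_real s * w)))"
    if n: "norm \<kappa> \<le> r" for \<kappa>
  proof (rule step)
    show "continuous_on {0..1} (\<lambda>s. f s * (1 / (1 - \<kappa> * of_real s)) * p (of_real s * w))"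
      by (intro continuous_on_mult contf contk[OF n] contp)
    show "\<delta> \<le> Re (integral {0..1} (\<lambda>s. f s * (1 / (1 - \<kappa> * of_real s)) * p (of_real s * w) * (1 / (1 - \<mu> * of_real s))))"
      if "norm \<mu> \<le> r" for \<mu>
      using 1[OF n that] by (simp only: mult_ac)
  qed
  have "\<delta> \<le> Re (integral {0..1} (\<lambda>s. f s * p (of_real s * w) * p (of_real s * w) * p (of_real s * w)))"
  proof (rule step)
    show "continuous_on {0..1} (\<lambda>s. f s * p (of_real s * w) * p (of_real s * w))"
      by (intro continuous_on_mult contf contp)
    show "\<delta> \<le> Re (integral {0..1} (\<lambda>s. f s * p (of_real s * w) * p (of_real s * w) * (1 / (1 - \<mu> * of_real s))))"
      if "norm \<mu> \<le> r" for \<mu>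
      using 2[OF that] by (simp only: mult_ac)
  qed
  then show ?thesis by (simp add: power3_eq_cube mult.assoc)
qed


section \<open>The radius of starlikeness of the analytic combinations\<close>

lemma has_integral_close_to_convex_kernel:
  fixes \<kappa> \<nu> :: complex
  assumes "norm \<kappa> < 1"
  shows "((\<lambda>s. (1 - \<nu> * of_real s) * (1 / (1 - \<kappa> * of_real s) ^ 3)) has_integral
           (1 / (1 - \<kappa>) + (1 - \<nu>) / (1 - \<kappa>)\<^sup>2) / 2) {0..1}"
proof -
  define F where "F \<equiv> \<lambda>s::complex. s * (1 - (\<nu> + \<kappa>) * s / 2) / (1 - \<kappa> * s)\<^sup>2"
  have "((\<lambda>s::real. F (of_real s)) has_vector_derivative (1 - \<nu> * of_real s) * (1 / (1 - \<kappa> * of_real s) ^ 3)) (at s within {0..1})"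
    if "s \<in> {0..1}" for s
  proof -
    have nz: "1 - \<kappa> * of_real s \<noteq> 0" using that assms by (intro one_minus_nonzero) auto
    have "(F has_field_derivative (1 - \<nu> * of_real s) * (1 / (1 - \<kappa> * of_real s) ^ 3)) (at (of_real s))"
    proof -
      define q where "q = 1 - \<kappa> * of_real s"
      have q: "q \<noteq> 0" using nz by (simp add: q_def)
      have "((\<lambda>s. s * (1 - (\<nu> + \<kappa>) * s / 2)) has_field_derivative 1 - (\<nu> + \<kappa>) * of_real s) (at (of_real s))"
        by (auto intro!: derivative_eq_intros simp: field_simps)
      moreover have "((\<lambda>s. (1 - \<kappa> * s)\<^sup>2) has_field_derivative - 2 * \<kappa> * q) (at (of_real s))"
        by (auto intro!: derivative_eq_intros simp: q_def)
      ultimately have "(F has_field_derivative ((1 - (\<nu> + \<kappa>) * of_real s) * q\<^sup>2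
          - (of_real s * (1 - (\<nu> + \<kappa>) * of_real s / 2)) * (- 2 * \<kappa> * q)) / (q\<^sup>2 * q\<^sup>2)) (at (of_real s))"
        using q unfolding F_def q_def by (intro DERIV_divide) auto
      moreover have "(1 - (\<nu> + \<kappa>) * of_real s) * q\<^sup>2 - (of_real s * (1 - (\<nu> + \<kappa>) * of_real s / 2)) * (- 2 * \<kappa> * q)
          = (1 - \<nu> * of_real s) * q"
        by (simp add: q_def power2_eq_square field_simps)
      moreover have "(1 - \<nu> * of_real s) * q / (q\<^sup>2 * q\<^sup>2) = (1 - \<nu> * of_real s) * (1 / q ^ 3)"
        using q by (simp add: power2_eq_square power3_eq_cube)
      ultimately show ?thesis by (simp add: q_def)
    qed
    then show ?thesis by (rule has_vector_derivative_real_field[OF has_field_derivative_at_within])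
  qed
  from fundamental_theorem_of_calculus[OF _ this]
  have "((\<lambda>s. (1 - \<nu> * of_real s) * (1 / (1 - \<kappa> * of_real s) ^ 3)) has_integral F 1 - F 0) {0..1}" by simp
  moreover have "F 1 - F 0 = (1 / (1 - \<kappa>) + (1 - \<nu>) / (1 - \<kappa>)\<^sup>2) / 2"
    using one_minus_nonzero[OF assms, of 1] by (simp add: F_def divide_simps power2_eq_square) (simp add: algebra_simps)
  ultimately show ?thesis by simp
qed

text \<open>
  Put \<open>u = 1 - \<kappa>\<close> and \<open>a = Re (1 / u)\<close>. The worst \<open>\<nu>\<close> gives the lower bound
  \<open>a + 2 a\<^sup>2 - (1 + r) / |u|\<^sup>2\<close>, and \<open>|u - 1| \<le> r\<close> gives \<open>(1 - r\<^sup>2) / |u|\<^sup>2 \<le> 2 a - 1\<close>. This leaves the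
  quadratic \<open>2 a\<^sup>2 + a - (2 a - 1) / (1 - r)\<close> in \<open>a\<close>. Its discriminant vanishes when
  \<open>1 / (1 - r) = (3 + 2 sqrt 2) / 2\<close>, that is for \<open>r = 4 sqrt 2 - 5\<close>. For smaller \<open>r\<close> the bound on the
  left is the gain over the perfect square, with \<open>2 a - 1\<close> estimated from below.
\<close>

lemma close_to_convex_kernel_bound:
  fixes \<kappa> \<nu> :: complex
  assumes \<kappa>: "norm \<kappa> \<le> r" and \<nu>: "norm \<nu> \<le> r" and r: "r < 4 * sqrt 2 - 5"
  shows "(1 - r) / (1 + r) * ((3 + 2 * sqrt 2) / 2 - 1 / (1 - r)) \<le> Re (1 / (1 - \<kappa>) + (1 - \<nu>) / (1 - \<kappa>)\<^sup>2)"
    and "(1 - r) / (1 + r) * ((3 + 2 * sqrt 2) / 2 - 1 / (1 - r)) > 0"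
proof -
  have "sqrt 2 < 3 / 2" by (rule real_less_lsqrt) (auto simp: power2_eq_square)
  then have r01: "0 \<le> r" "r < 1" using \<kappa> norm_ge_zero[of \<kappa>] r by linarith+
  have s2: "sqrt 2 * sqrt 2 = 2" by simp
  have "sqrt 2 > 0" by simp
  have less: "1 / (1 - r) < (3 + 2 * sqrt 2) / 2"
  proof -
    have "(3 + 2 * sqrt 2) * (1 - r) > (3 + 2 * sqrt 2) * (6 - 4 * sqrt 2)"
      using r \<open>sqrt 2 > 0\<close> by (intro mult_strict_left_mono add_pos_nonneg) simp_all
    also have "(3 + 2 * sqrt 2) * (6 - 4 * sqrt 2) = 2" using s2 by (simp add: algebra_simps)
    finally show ?thesis using r01 by (simp add: field_simps)
  qed
  show "(1 - r) / (1 + r) * ((3 + 2 * sqrt 2) / 2 - 1 / (1 - r)) > 0"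
    using less r01 by simp
  define u where "u = 1 - \<kappa>"
  define a where "a = Re (1 / u)"
  define m where "m = (norm (1 / u))\<^sup>2"
  have "norm u \<ge> 1 - r" "norm u \<le> 1 + r"
    using \<kappa> norm_triangle_ineq2[of 1 \<kappa>] norm_triangle_ineq4[of 1 \<kappa>] by (auto simp: u_def)
  then have u: "norm u > 0" "u \<noteq> 0" using r01 by auto
  have m_lower: "m \<ge> 1 / (1 + r)\<^sup>2"
    using u r01 \<open>norm u \<le> 1 + r\<close>
    by (auto simp: m_def norm_divide power_divide intro!: divide_left_mono power_mono mult_pos_pos)
  have m_upper: "(1 - r\<^sup>2) * m \<le> 2 * a - 1"
  proof -
    have "(norm \<kappa>)\<^sup>2 \<le> r\<^sup>2" using \<kappa> by (intro power_mono) auto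
    then have "(norm u)\<^sup>2 - 2 * Re u + 1 \<le> r\<^sup>2"
      unfolding cmod_power2 by (simp add: u_def power2_eq_square algebra_simps)
    moreover have "Re u = a * (norm u)\<^sup>2" using u by (simp add: a_def Re_divide' cmod_power2)
    ultimately have "1 - r\<^sup>2 \<le> (2 * a - 1) * (norm u)\<^sup>2" by (simp add: algebra_simps)
    moreover have "m = 1 / (norm u)\<^sup>2" by (simp add: m_def norm_divide power_divide)
    ultimately show ?thesis using u by (simp add: pos_divide_le_eq)
  qed
  have *: "Re ((1 - \<nu>) / u\<^sup>2) \<ge> 2 * a\<^sup>2 - (1 + r) * m"
  proof -
    have "Re ((1 / u)\<^sup>2) = 2 * a\<^sup>2 - m"
      unfolding m_def a_def cmod_power2 by (simp add: Re_power2)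
    moreover have "Re (\<nu> * (1 / u)\<^sup>2) \<le> r * m"
    proof -
      have "Re (\<nu> * (1 / u)\<^sup>2) \<le> norm \<nu> * m"
        using complex_Re_le_cmod[of "\<nu> * (1 / u)\<^sup>2"] by (simp add: norm_mult norm_power m_def)
      also have "\<dots> \<le> r * m" using \<nu> by (intro mult_right_mono) (auto simp: m_def)
      finally show ?thesis .
    qed
    moreover have "(1 - \<nu>) / u\<^sup>2 = (1 / u)\<^sup>2 - \<nu> * (1 / u)\<^sup>2"
      by (simp add: power_divide diff_divide_distrib)
    then have "Re ((1 - \<nu>) / u\<^sup>2) = Re ((1 / u)\<^sup>2) - Re (\<nu> * (1 / u)\<^sup>2)"
      by (simp only: minus_complex.sel)
    moreover have "(1 + r) * m = m + r * m" by (simp add: algebra_simps)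
    ultimately show ?thesis by linarith
  qed
  have mm: "(1 + r) * m \<le> (2 * a - 1) / (1 - r)"
    using m_upper r01 by (simp add: field_simps power2_eq_square)
  have "(1 - r) / (1 + r) \<le> 2 * a - 1"
  proof -
    have "(1 - r\<^sup>2) * (1 / (1 + r)\<^sup>2) \<le> (1 - r\<^sup>2) * m"
      using m_lower r01 by (intro mult_left_mono) (auto simp: power_le_one)
    also have "(1 - r\<^sup>2) * (1 / (1 + r)\<^sup>2) = (1 - r) / (1 + r)"
    proof -
      have "1 - r\<^sup>2 = (1 - r) * (1 + r)" by (simp add: power2_eq_square algebra_simps)
      then show ?thesis using r01 by (simp add: power2_eq_square)
    qed
    finally show ?thesis using m_upper by linarith
  qed
  then have "(1 - r) / (1 + r) * ((3 + 2 * sqrt 2) / 2 - 1 / (1 - r)) \<le> (2 * a - 1) * ((3 + 2 * sqrt 2) / 2 - 1 / (1 - r))"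
    using less by (intro mult_right_mono) auto
  also have "\<dots> = (2 * a - 1) * ((3 + 2 * sqrt 2) / 2) - (2 * a - 1) / (1 - r)"
    by (simp only: right_diff_distrib times_divide_eq_right mult_1_right)
  also have "\<dots> \<le> (a + 2 * a\<^sup>2) - (2 * a - 1) / (1 - r)"
  proof -
    have "0 \<le> 2 * (a - (1 + sqrt 2) / 2)\<^sup>2" by simp
    also have "\<dots> = (a + 2 * a\<^sup>2) - (2 * a - 1) * ((3 + 2 * sqrt 2) / 2)"
      using s2 by (simp add: power2_eq_square field_simps)
    finally show ?thesis by simp
  qed
  also have "\<dots> \<le> a + Re ((1 - \<nu>) / u\<^sup>2)" using * mm by linarith
  finally show "(1 - r) / (1 + r) * ((3 + 2 * sqrt 2) / 2 - 1 / (1 - r)) \<le> Re (1 / (1 - \<kappa>) + (1 - \<nu>) / (1 - \<kappa>)\<^sup>2)"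
    by (simp add: a_def u_def)
qed

text \<open>
  For \<open>Y \<noteq> 0\<close> this says that a disc automorphism maps \<open>X / Y\<close> into the closed unit disc; the homogeneous
  form avoids a case distinction for \<open>Y = 0\<close>.
\<close>

lemma norm_Moebius_numerator_le:
  fixes a X Y :: complex
  assumes "norm a < 1" "norm X \<le> norm Y"
  shows "norm (X - cnj a * Y) \<le> norm (Y - a * X)"
proof -
  have "(norm (Y - a * X))\<^sup>2 - (norm (X - cnj a * Y))\<^sup>2 = (1 - (norm a)\<^sup>2) * ((norm Y)\<^sup>2 - (norm X)\<^sup>2)"
    unfolding cmod_power2 by (simp add: power2_eq_square algebra_simps)
  also have "\<dots> \<ge> 0"
    using assms by (intro mult_nonneg_nonneg) (auto simp: power_le_one power_mono)
  finally have "(norm (X - cnj a * Y))\<^sup>2 \<le> (norm (Y - a * X))\<^sup>2" by linarith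
  then show ?thesis by (rule power2_le_imp_le) simp
qed

lemma disc_automorphism:
  fixes a :: complex
  assumes a: "norm a < 1"
  defines "\<phi> \<equiv> \<lambda>\<zeta>. (\<zeta> + a) / (1 + cnj a * \<zeta>)"
  assumes \<zeta>: "norm \<zeta> < 1"
  shows "1 + cnj a * \<zeta> \<noteq> 0" and "norm (\<phi> \<zeta>) < 1"
    and "(\<phi> has_field_derivative of_real (1 - (norm a)\<^sup>2) / (1 + cnj a * \<zeta>)\<^sup>2) (at \<zeta>)"
proof -
  have "norm (cnj a * \<zeta>) < 1"
    using a \<zeta> mult_strict_mono'[of "norm a" 1 "norm \<zeta>" 1] by (simp add: norm_mult)
  then show nz: "1 + cnj a * \<zeta> \<noteq> 0"
    by (metis add.inverse_inverse add_eq_0_iff less_irrefl norm_minus_cancel norm_one)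
  have "(norm (1 + cnj a * \<zeta>))\<^sup>2 - (norm (\<zeta> + a))\<^sup>2 = (1 - (norm a)\<^sup>2) * (1 - (norm \<zeta>)\<^sup>2)"
    unfolding cmod_power2 by (simp add: power2_eq_square algebra_simps)
  also have "\<dots> > 0"
    using a \<zeta> by (intro mult_pos_pos) (auto simp: abs_square_less_1)
  finally have "norm (\<zeta> + a) < norm (1 + cnj a * \<zeta>)"
    by (simp add: power2_less_imp_less)
  then show "norm (\<phi> \<zeta>) < 1" using nz by (simp add: \<phi>_def norm_divide)
  have "(\<phi> has_field_derivative ((1 + cnj a * \<zeta>) - (\<zeta> + a) * cnj a) / ((1 + cnj a * \<zeta>) * (1 + cnj a * \<zeta>))) (at \<zeta>)"
    unfolding \<phi>_def using nz by (auto intro!: derivative_eq_intros)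
  moreover have "(1 + cnj a * \<zeta>) - (\<zeta> + a) * cnj a = of_real (1 - (norm a)\<^sup>2)"
    using complex_norm_square[of a] by (simp add: algebra_simps)
  ultimately show "(\<phi> has_field_derivative of_real (1 - (norm a)\<^sup>2) / (1 + cnj a * \<zeta>)\<^sup>2) (at \<zeta>)"
    by (simp add: power2_eq_square)
qed

text \<open>
  If \<open>p\<^sup>2\<close> is the derivative of a convex function, then \<open>q\<^sup>2\<close> is, up to a constant factor, the derivative
  of its composition with a disc automorphism. In terms of the function \<open>\<omega>\<close> with
  \<open>p'/p = \<omega> / (1 - z \<omega>)\<close>, the composition replaces \<open>\<omega>\<close> by \<open>(\<omega> - cnj a) / (1 - a \<omega>)\<close>, taken at the image
  point, which is again bounded by \<open>1\<close>. Therefore \<open>Re (\<zeta> q'/q) > -1/2\<close>, and the theorem of Marx and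
  Strohhaecker applies to \<open>q\<close>.
\<close>

lemma Koebe_transform_half_plane:
  fixes p :: "complex \<Rightarrow> complex"
  assumes holp: "p holomorphic_on ball 0 1" and nz: "\<And>z. norm z < 1 \<Longrightarrow> p z \<noteq> 0"
    and Re_p: "\<And>z. norm z < 1 \<Longrightarrow> Re (z * (deriv p z / p z)) > - 1 / 2"
    and a: "norm a < 1"
  defines "q \<equiv> \<lambda>\<zeta>. p ((\<zeta> + a) / (1 + cnj a * \<zeta>)) / (p a * (1 + cnj a * \<zeta>))"
  shows "q holomorphic_on ball 0 1" and "q 0 = 1" and "\<And>\<zeta>. norm \<zeta> < 1 \<Longrightarrow> Re (q \<zeta>) > 1 / 2"
proof -
  define \<phi> where "\<phi> \<equiv> \<lambda>\<zeta>. (\<zeta> + a) / (1 + cnj a * \<zeta>)"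
  define L where "L \<equiv> \<lambda>z. deriv p z / p z"
  have \<phi>: "1 + cnj a * \<zeta> \<noteq> 0" "norm (\<phi> \<zeta>) < 1"
      "(\<phi> has_field_derivative of_real (1 - (norm a)\<^sup>2) / (1 + cnj a * \<zeta>)\<^sup>2) (at \<zeta>)"
    if "norm \<zeta> < 1" for \<zeta>
    unfolding \<phi>_def by (rule disc_automorphism[OF a that])+
  have pa: "p a \<noteq> 0" using nz a by blast
  have q_eq: "q \<zeta> = p (\<phi> \<zeta>) / (p a * (1 + cnj a * \<zeta>))" for \<zeta>
    by (simp add: q_def \<phi>_def)
  have holL: "L holomorphic_on ball 0 1"
    unfolding L_def by (intro holomorphic_intros holp) (use nz in auto)
  have L_le: "norm (L z) \<le> norm (1 + z * L z)" if "norm z < 1" for z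
    using Schwarz_log_derivative[OF holL _ that] Re_p by (simp add: L_def)
  have q_nz: "q \<zeta> \<noteq> 0" if "norm \<zeta> < 1" for \<zeta>
    using nz[OF \<phi>(2)[OF that]] \<phi>(1)[OF that] pa by (simp add: q_eq)
  have der_q: "(q has_field_derivative q \<zeta> * ((L (\<phi> \<zeta>) - cnj a * (1 + \<phi> \<zeta> * L (\<phi> \<zeta>))) / (1 + cnj a * \<zeta>))) (at \<zeta>)"
    if \<zeta>: "norm \<zeta> < 1" for \<zeta>
  proof -
    define D where "D = 1 + cnj a * \<zeta>"
    have D: "D \<noteq> 0" using \<phi>(1)[OF \<zeta>] by (simp add: D_def)
    define P where "P = p (\<phi> \<zeta>)"
    have P: "P \<noteq> 0" using nz[OF \<phi>(2)[OF \<zeta>]] by (simp add: P_def)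
    have dp: "(p has_field_derivative L (\<phi> \<zeta>) * P) (at (\<phi> \<zeta>))"
      using holomorphic_derivI[OF holp open_ball, of "\<phi> \<zeta>"] \<phi>(2)[OF \<zeta>] P by (simp add: L_def P_def)
    from DERIV_chain2[OF dp \<phi>(3)[OF \<zeta>]]
    have "((\<lambda>\<zeta>. p (\<phi> \<zeta>)) has_field_derivative L (\<phi> \<zeta>) * P * (of_real (1 - (norm a)\<^sup>2) / D\<^sup>2)) (at \<zeta>)"
      by (simp add: D_def)
    moreover have "((\<lambda>\<zeta>. p a * (1 + cnj a * \<zeta>)) has_field_derivative p a * cnj a) (at \<zeta>)"
      by (auto intro!: derivative_eq_intros)
    ultimately have "((\<lambda>\<zeta>. p (\<phi> \<zeta>) / (p a * (1 + cnj a * \<zeta>))) has_field_derivative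
       ((L (\<phi> \<zeta>) * P * (of_real (1 - (norm a)\<^sup>2) / D\<^sup>2)) * (p a * D) - P * (p a * cnj a)) / ((p a * D) * (p a * D))) (at \<zeta>)"
      unfolding D_def P_def using pa \<phi>(1)[OF \<zeta>] by (intro DERIV_divide) auto
    moreover have "((L (\<phi> \<zeta>) * P * (of_real (1 - (norm a)\<^sup>2) / D\<^sup>2)) * (p a * D) - P * (p a * cnj a)) / ((p a * D) * (p a * D))
       = P / (p a * D) * ((L (\<phi> \<zeta>) * of_real (1 - (norm a)\<^sup>2) - cnj a * D) / (D * D))"
      using pa D by (simp add: field_simps power2_eq_square)
    moreover have "L (\<phi> \<zeta>) * of_real (1 - (norm a)\<^sup>2) - cnj a * D = (L (\<phi> \<zeta>) - cnj a * (1 + \<phi> \<zeta> * L (\<phi> \<zeta>))) * D"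
    proof -
      have "\<phi> \<zeta> * D = \<zeta> + a" using D by (simp add: \<phi>_def D_def)
      moreover have "(L (\<phi> \<zeta>) - cnj a * (1 + \<phi> \<zeta> * L (\<phi> \<zeta>))) * D = L (\<phi> \<zeta>) * D - cnj a * D - cnj a * L (\<phi> \<zeta>) * (\<phi> \<zeta> * D)"
        by (simp add: algebra_simps)
      ultimately have "(L (\<phi> \<zeta>) - cnj a * (1 + \<phi> \<zeta> * L (\<phi> \<zeta>))) * D = L (\<phi> \<zeta>) * D - cnj a * D - cnj a * L (\<phi> \<zeta>) * (\<zeta> + a)"
        by simp
      then show ?thesis using complex_norm_square[of a] by (simp add: D_def algebra_simps)
    qed
    ultimately show ?thesis using D unfolding q_eq P_def D_def by (simp add: mult.assoc)
  qed
  have holq: "q holomorphic_on ball 0 1"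
    unfolding holomorphic_on_open[OF open_ball] using der_q by (metis mem_ball_0)
  moreover have q0: "q 0 = 1" using pa by (simp add: q_def)
  moreover have "Re (q \<zeta>) > 1 / 2" if "norm \<zeta> < 1" for \<zeta>
  proof (rule Marx_Strohhaecker[OF holq q_nz q0 _ that])
    fix \<zeta> :: complex assume \<zeta>: "norm \<zeta> < 1"
    define D where "D = 1 + cnj a * \<zeta>"
    define X where "X = L (\<phi> \<zeta>)"
    define Y where "Y = 1 + \<phi> \<zeta> * X"
    have D: "D \<noteq> 0" "\<phi> \<zeta> * D = \<zeta> + a"
      using \<phi>(1)[OF \<zeta>] by (auto simp: D_def \<phi>_def)
    have le: "norm (X - cnj a * Y) \<le> norm (Y - a * X)"
      using a L_le[OF \<phi>(2)[OF \<zeta>]] unfolding X_def Y_def by (intro norm_Moebius_numerator_le) auto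
    have eq: "D + \<zeta> * (X - cnj a * Y) = Y - a * X"
      using arg_cong[OF D(2), of "\<lambda>t. t * X"] by (simp add: Y_def D_def algebra_simps)
    have YX: "Y - a * X \<noteq> 0"
    proof
      assume "Y - a * X = 0"
      with le have "X - cnj a * Y = 0" by simp
      with eq \<open>Y - a * X = 0\<close> D(1) show False by simp
    qed
    have "norm (\<zeta> * (X - cnj a * Y)) \<le> norm \<zeta> * norm (Y - a * X)"
      unfolding norm_mult using le by (intro mult_left_mono) auto
    also have "\<dots> < norm (Y - a * X)" using \<zeta> YX by simp
    finally have "norm (\<zeta> * (X - cnj a * Y) / D) < norm (1 + \<zeta> * (X - cnj a * Y) / D)"
      using D(1) eq by (simp add: norm_divide divide_simps) 
    then have "Re (\<zeta> * (X - cnj a * Y) / D) > - 1 / 2"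
      using norm_less_norm_one_plus_iff by blast
    moreover have "\<zeta> * deriv q \<zeta> / q \<zeta> = \<zeta> * (X - cnj a * Y) / D"
      using DERIV_imp_deriv[OF der_q[OF \<zeta>]] q_nz[OF \<zeta>] by (simp add: X_def Y_def D_def)
    ultimately show "Re (\<zeta> * deriv q \<zeta> / q \<zeta>) > - 1 / 2" by simp
  qed
  ultimately show "q holomorphic_on ball 0 1" "q 0 = 1" "\<And>\<zeta>. norm \<zeta> < 1 \<Longrightarrow> Re (q \<zeta>) > 1 / 2" by auto
qed

text \<open>
  With \<open>K = F \<circ> \<phi>\<close> for the automorphism \<open>\<phi>\<close> that maps \<open>0\<close> to \<open>a\<close> and \<open>-a\<close> to \<open>0\<close>, one has
  \<open>F(a) = K(0) - K(-a)\<close>. The chain rule contributes \<open>(1 + cnj a \<zeta>)\<close> to the power \<open>-2\<close>, the factor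
  \<open>1 + \<epsilon> \<phi>\<close> contributes the power \<open>-1\<close>, and \<open>p\<^sup>3\<close> the power \<open>3\<close>. These cancel, so \<open>K'\<close> is a constant
  multiple of \<open>(1 - x \<zeta>) q(\<zeta>)\<^sup>3\<close>, a function of the same type as \<open>F'\<close>. What was a quotient of values of
  \<open>F\<close> and \<open>F'\<close> has become linear in \<open>q\<^sup>3\<close>.
\<close>

lemma starlike_radius_analytic:
  fixes p F :: "complex \<Rightarrow> complex"
  assumes holp: "p holomorphic_on ball 0 1" and nz: "\<And>z. norm z < 1 \<Longrightarrow> p z \<noteq> 0"
    and Re_p: "\<And>z. norm z < 1 \<Longrightarrow> Re (z * (deriv p z / p z)) > - 1 / 2"
    and \<epsilon>: "norm \<epsilon> \<le> 1"
    and derF: "\<And>z. norm z < 1 \<Longrightarrow> (F has_field_derivative (1 + \<epsilon> * z) * p z ^ 3) (at z)"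
    and F0: "F 0 = 0"
    and a: "a \<noteq> 0" "norm a < 4 * sqrt 2 - 5"
  shows "Re (F a / (a * ((1 + \<epsilon> * a) * p a ^ 3))) > 0"
proof -
  have "sqrt 2 < 3 / 2" by (rule real_less_lsqrt) (auto simp: power2_eq_square)
  then have a1: "norm a < 1" using a(2) by linarith
  define \<phi> where "\<phi> \<equiv> \<lambda>\<zeta>. (\<zeta> + a) / (1 + cnj a * \<zeta>)"
  have \<phi>: "1 + cnj a * \<zeta> \<noteq> 0" "norm (\<phi> \<zeta>) < 1"
      "(\<phi> has_field_derivative of_real (1 - (norm a)\<^sup>2) / (1 + cnj a * \<zeta>)\<^sup>2) (at \<zeta>)"
    if "norm \<zeta> < 1" for \<zeta>
    unfolding \<phi>_def by (rule disc_automorphism[OF a1 that])+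
  define q where "q \<equiv> \<lambda>\<zeta>. p (\<phi> \<zeta>) / (p a * (1 + cnj a * \<zeta>))"
  have q: "q holomorphic_on ball 0 1" "q 0 = 1" "\<And>\<zeta>. norm \<zeta> < 1 \<Longrightarrow> Re (q \<zeta>) > 1 / 2"
    unfolding q_def \<phi>_def by (rule Koebe_transform_half_plane[OF holp nz Re_p a1]; assumption)+
  have pa: "p a \<noteq> 0" using nz a1 by blast
  have ea: "1 + \<epsilon> * a \<noteq> 0"
  proof -
    have "norm (\<epsilon> * a) \<le> norm a" using \<epsilon> by (simp add: norm_mult mult_left_le_one_le)
    then have "norm (\<epsilon> * a) < 1" using a1 by linarith
    then show ?thesis by (metis add.inverse_inverse add_eq_0_iff less_irrefl norm_minus_cancel norm_one)
  qed
  define x where "x = - (\<epsilon> + cnj a) / (1 + \<epsilon> * a)"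
  have x: "norm x \<le> 1"
  proof -
    have "norm (\<epsilon> - cnj a * (- 1)) \<le> norm (- 1 - a * \<epsilon>)"
      by (rule norm_Moebius_numerator_le[OF a1]) (use \<epsilon> in auto)
    moreover have "norm (- 1 - a * \<epsilon>) = norm (1 + \<epsilon> * a)"
      by (metis add.commute minus_add_distrib mult.commute norm_minus_cancel uminus_add_conv_diff diff_minus_eq_add)
    ultimately show ?thesis using ea unfolding x_def norm_divide norm_minus_cancel by simp
  qed
  define N where "N = 1 - (norm a)\<^sup>2"
  have N: "N > 0" using a1 by (simp add: N_def abs_square_less_1)
  define C where "C = of_real N * ((1 + \<epsilon> * a) * p a ^ 3)"
  have derK: "((\<lambda>\<zeta>. F (\<phi> \<zeta>)) has_field_derivative C * ((1 - x * \<zeta>) * q \<zeta> ^ 3)) (at \<zeta>)" if \<zeta>: "norm \<zeta> < 1" for \<zeta>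
  proof -
    define D where "D = 1 + cnj a * \<zeta>"
    have D: "D \<noteq> 0" "\<phi> \<zeta> * D = \<zeta> + a"
      using \<phi>(1)[OF \<zeta>] by (auto simp: D_def \<phi>_def)
    have "((\<lambda>\<zeta>. F (\<phi> \<zeta>)) has_field_derivative (1 + \<epsilon> * \<phi> \<zeta>) * p (\<phi> \<zeta>) ^ 3 * (of_real N / D\<^sup>2)) (at \<zeta>)"
      using DERIV_chain2[OF derF[OF \<phi>(2)[OF \<zeta>]] \<phi>(3)[OF \<zeta>]] by (simp add: N_def D_def)
    moreover have "(1 + \<epsilon> * \<phi> \<zeta>) * p (\<phi> \<zeta>) ^ 3 * (of_real N / D\<^sup>2) = C * ((1 - x * \<zeta>) * q \<zeta> ^ 3)"
    proof -
      have 1: "p (\<phi> \<zeta>) = q \<zeta> * p a * D" using pa D by (simp add: q_def D_def)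
      have 2: "(1 + \<epsilon> * a) * (1 - x * \<zeta>) = (1 + \<epsilon> * \<phi> \<zeta>) * D"
      proof -
        have "(1 + \<epsilon> * a) * x = - (\<epsilon> + cnj a)" using ea by (simp add: x_def)
        then have "(1 + \<epsilon> * a) * (1 - x * \<zeta>) = (1 + \<epsilon> * a) + (\<epsilon> + cnj a) * \<zeta>"
          by (metis (no_types, opaque_lifting) diff_minus_eq_add mult.assoc mult.right_neutral mult_minus_left right_diff_distrib)
        also have "\<dots> = D + \<epsilon> * (\<phi> \<zeta> * D)" unfolding D(2) by (simp add: D_def algebra_simps)
        also have "\<dots> = (1 + \<epsilon> * \<phi> \<zeta>) * D" by (simp add: algebra_simps)
        finally show ?thesis .
      qed
      have "C * ((1 - x * \<zeta>) * q \<zeta> ^ 3) = of_real N * ((1 + \<epsilon> * a) * (1 - x * \<zeta>)) * (q \<zeta> * p a) ^ 3"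
        by (simp add: C_def power_mult_distrib mult_ac)
      also have "\<dots> = (1 + \<epsilon> * \<phi> \<zeta>) * of_real N * ((q \<zeta> * p a) ^ 3 * D)" by (simp add: 2)
      also have "(q \<zeta> * p a) ^ 3 * D = (q \<zeta> * p a * D) ^ 3 / D\<^sup>2"
        using D(1) by (simp add: power_mult_distrib power2_eq_square power3_eq_cube)
      finally show ?thesis by (simp add: 1)
    qed
    ultimately show ?thesis by simp
  qed
  define w where "w = - a"
  have w: "w \<noteq> 0" "norm w = norm a" using a by (auto simp: w_def)
  define I where "I = integral {0..1} (\<lambda>s. (1 - x * (of_real s * w)) * q (of_real s * w) ^ 3)"
  have sw: "norm (of_real s * w) < 1" if "s \<in> {0..1}" for s
  proof -
    have "norm (of_real s * w) \<le> norm w" using that by (simp add: norm_mult mult_left_le_one_le)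
    then show ?thesis using w a1 by linarith
  qed
  have "F a = a * C * I"
  proof -
    have "((\<lambda>s. F (\<phi> (of_real s * w))) has_vector_derivative
            (C * w) * ((1 - x * (of_real s * w)) * q (of_real s * w) ^ 3)) (at s within {0..1})" if "s \<in> {0..1}" for s
    proof -
      have "((\<lambda>t. t * w) has_field_derivative w) (at (of_real s))" by (auto intro!: derivative_eq_intros)
      from DERIV_chain2[OF derK[OF sw[OF that]] this]
      have "((\<lambda>t. F (\<phi> (t * w))) has_field_derivative (C * w) * ((1 - x * (of_real s * w)) * q (of_real s * w) ^ 3)) (at (of_real s))"
        by (rule DERIV_cong) (simp only: ac_simps)
      then show ?thesis by (rule has_vector_derivative_real_field[OF has_field_derivative_at_within])
    qed
    from fundamental_theorem_of_calculus[OF _ this]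
    have "((\<lambda>s. (C * w) * ((1 - x * (of_real s * w)) * q (of_real s * w) ^ 3)) has_integral F (\<phi> w) - F (\<phi> 0)) {0..1}"
      by simp
    moreover have "F (\<phi> w) - F (\<phi> 0) = - F a" by (simp add: \<phi>_def w_def F0)
    ultimately have "((\<lambda>s. (C * w) * ((1 - x * (of_real s * w)) * q (of_real s * w) ^ 3)) has_integral - F a) {0..1}"
      by (simp only:)
    from integral_unique[OF this] have "(C * w) * I = - F a" by (simp only: integral_mult_right I_def)
    then show ?thesis by (simp add: w_def mult_ac)
  qed
  then have quot: "F a / (a * ((1 + \<epsilon> * a) * p a ^ 3)) = of_real N * I"
    using a ea pa by (simp add: C_def)
  \<comment> \<open>The averaging over kernels needs a radius strictly between \<open>|a|\<close> and the critical one.\<close>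
  obtain r where r: "norm a < r" "r < 4 * sqrt 2 - 5" using dense[OF a(2)] by blast
  have r1: "r < 1" using r(2) \<open>sqrt 2 < 3 / 2\<close> by linarith
  define \<delta> where "\<delta> = (1 - r) / (1 + r) * ((3 + 2 * sqrt 2) / 2 - 1 / (1 - r)) / 2"
  have xw: "norm (x * w) \<le> r"
    using mult_mono[OF x order_refl, of "norm w"] r w by (simp add: norm_mult)
  have "\<delta> > 0" unfolding \<delta>_def by (intro half_gt_zero close_to_convex_kernel_bound(2)[OF xw xw r(2)])
  also have "\<delta> \<le> Re I"
    unfolding I_def
  proof (rule Re_integral_half_plane_cube[OF q _ _ r1])
    show "continuous_on {0..1} (\<lambda>s. 1 - x * (of_real s * w))" by (intro continuous_intros)
    fix \<kappa> :: complex assume \<kappa>: "norm \<kappa> \<le> r"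
    have xws: "x * (of_real s * w) = (x * w) * of_real s" for s by (simp add: mult_ac)
    have "integral {0..1} (\<lambda>s. (1 - x * (of_real s * w)) * (1 / (1 - \<kappa> * of_real s) ^ 3))
      = (1 / (1 - \<kappa>) + (1 - x * w) / (1 - \<kappa>)\<^sup>2) / 2"
      unfolding xws using \<kappa> r1 by (intro integral_unique has_integral_close_to_convex_kernel) auto
    then show "\<delta> \<le> Re (integral {0..1} (\<lambda>s. (1 - x * (of_real s * w)) * (1 / (1 - \<kappa> * of_real s) ^ 3)))"
      using divide_right_mono[OF close_to_convex_kernel_bound(1)[OF \<kappa> xw r(2)], of 2]
      by (simp only: \<delta>_def Re_divide_numeral)
  qed (use w r in auto)
  finally show ?thesis using N by (simp add: quot)
qed

section \<open>Starlike images under harmonic maps\<close>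

text \<open>
  Here \<open>A = z h'\<close> and \<open>B = z g'\<close>. Write \<open>\<alpha> = Re (A cnj h)\<close> and \<open>\<beta> = Re (B cnj g)\<close>. Choosing the worst
  argument of \<open>\<epsilon>\<close> turns the hypothesis into \<open>\<alpha> + t\<^sup>2 \<beta> > t |P|\<close> for \<open>t = |\<epsilon>|\<close>, and the conclusion follows
  from \<open>\<alpha> - \<beta> > |Q|\<close>. The two are linked by the identity \<open>(\<alpha> + \<beta>)\<^sup>2 - |P|\<^sup>2 = (\<alpha> - \<beta>)\<^sup>2 - |Q|\<^sup>2\<close>, and
  values of \<open>t\<close> below \<open>1\<close> settle the sign of \<open>\<alpha> - \<beta>\<close>.
\<close>

lemma Re_harmonic_angular_derivative_pos:
  fixes A B h g :: complex
  assumes pos: "\<And>\<epsilon>. norm \<epsilon> \<le> 1 \<Longrightarrow> Re ((A + \<epsilon> * B) * cnj (h + \<epsilon> * g)) > 0"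
  shows "Re ((A - cnj B) * cnj (h + cnj g)) > 0"
proof -
  define \<alpha> \<beta> where "\<alpha> = Re (A * cnj h)" and "\<beta> = Re (B * cnj g)"
  define P Q where "P = cnj A * g + B * cnj h" and "Q = A * g - B * h"
  have scaled: "\<alpha> + t\<^sup>2 * \<beta> > t * norm P" if t: "0 \<le> t" "t \<le> 1" for t
  proof -
    obtain u where u: "norm u = 1" "u * P = - of_real (norm P)"
    proof (cases "P = 0")
      case True
      show ?thesis by (rule that[of 1]) (use True in auto)
    next
      case False
      show ?thesis
      proof (rule that[of "- cnj (sgn P)"])
        show "norm (- cnj (sgn P)) = 1" using False by (simp add: norm_sgn)
        have "cnj P * P = of_real (norm P * norm P)"
          using complex_norm_square[of P] by (simp add: mult.commute power2_eq_square)
        then have "cnj (sgn P) * P = of_real (norm P)" using False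
          by (simp add: sgn_eq field_simps)
        then show "- cnj (sgn P) * P = - of_real (norm P)" by simp
      qed
    qed
    have uu: "u * cnj u = 1" using u(1) complex_norm_square[of u] by simp
    have "(A + of_real t * u * B) * cnj (h + of_real t * u * g)
        = A * cnj h + of_real (t\<^sup>2) * (u * cnj u) * (B * cnj g) + of_real t * (cnj (u * (cnj A * g)) + u * (B * cnj h))"
      by (simp add: algebra_simps power2_eq_square)
    then have "Re ((A + of_real t * u * B) * cnj (h + of_real t * u * g))
        = \<alpha> + t\<^sup>2 * \<beta> + t * (Re (cnj (u * (cnj A * g))) + Re (u * (B * cnj h)))"
      unfolding uu by (simp only: \<alpha>_def \<beta>_def plus_complex.sel mult_1_right scaleR_conv_of_real[symmetric] scaleR_complex.sel)
    also have "Re (cnj (u * (cnj A * g))) + Re (u * (B * cnj h)) = Re (u * P)"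
      unfolding P_def distrib_left by (simp only: plus_complex.sel complex_cnj cnj.sel)
    also have "Re (u * P) = - norm P" by (simp add: u(2))
    finally show ?thesis
      using pos[of "of_real t * u"] t u(1) by (simp add: norm_mult)
  qed
  have identity: "(norm P)\<^sup>2 = 4 * \<alpha> * \<beta> + (norm Q)\<^sup>2"
    unfolding cmod_power2 P_def Q_def \<alpha>_def \<beta>_def by (simp add: power2_eq_square algebra_simps)
  have "\<alpha> > 0" using scaled[of 0] by simp
  have "\<alpha> > \<beta>"
  proof (rule ccontr)
    assume "\<not> \<alpha> > \<beta>"
    then have "\<beta> > 0" "\<alpha> / \<beta> \<le> 1" using \<open>\<alpha> > 0\<close> by auto
    \<comment> \<open>With this modulus of \<open>\<epsilon>\<close> the terms \<open>\<alpha>\<close> and \<open>t\<^sup>2 \<beta>\<close> are equal.\<close>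
    define t where "t = sqrt (\<alpha> / \<beta>)"
    have t: "0 \<le> t" "t \<le> 1" "t\<^sup>2 = \<alpha> / \<beta>" using \<open>\<alpha> > 0\<close> \<open>\<beta> > 0\<close> \<open>\<alpha> / \<beta> \<le> 1\<close> by (auto simp: t_def)
    have "t * norm P < 2 * \<alpha>" using scaled[OF t(1,2)] t(3) \<open>\<beta> > 0\<close> by simp
    then have "(t * norm P)\<^sup>2 < (2 * \<alpha>)\<^sup>2" using t(1) by (intro power_strict_mono) auto
    moreover have "(t * norm P)\<^sup>2 = 4 * \<alpha>\<^sup>2 + \<alpha> / \<beta> * (norm Q)\<^sup>2"
      unfolding power_mult_distrib t(3) identity using \<open>\<beta> > 0\<close> by (simp add: field_simps power2_eq_square)
    moreover have "\<alpha> / \<beta> * (norm Q)\<^sup>2 \<ge> 0" using \<open>\<alpha> > 0\<close> \<open>\<beta> > 0\<close> by simp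
    ultimately show False by (simp add: power_mult_distrib)
  qed
  have "(norm P)\<^sup>2 < (\<alpha> + \<beta>)\<^sup>2" using scaled[of 1] by (intro power_strict_mono) auto
  then have "(norm Q)\<^sup>2 < (\<alpha> - \<beta>)\<^sup>2" unfolding identity by (simp add: power2_eq_square algebra_simps)
  then have "norm Q < \<alpha> - \<beta>" using \<open>\<alpha> > \<beta>\<close> by (auto intro: power2_less_imp_less[of _ "\<alpha> - \<beta>"])
  moreover have "- Re Q \<le> norm Q" using abs_Re_le_cmod[of Q] by linarith
  moreover have "Re ((A - cnj B) * cnj (h + cnj g)) = \<alpha> - \<beta> + Re Q"
    by (simp add: \<alpha>_def \<beta>_def Q_def algebra_simps)
  ultimately show ?thesis by linarith
qed

locale sense_preserving_harmonic =
  fixes h g :: "complex \<Rightarrow> complex" and S :: "complex set"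
  assumes open_S: "open S" and holh: "h holomorphic_on S" and holg: "g holomorphic_on S"
    and dilatation: "\<And>z. z \<in> S \<Longrightarrow> norm (deriv g z) < norm (deriv h z)"
begin

definition harmonic_map :: "complex \<Rightarrow> complex" where "harmonic_map z = h z + cnj (g z)"

definition tangent_map :: "complex \<Rightarrow> complex \<Rightarrow>\<^sub>L complex" where
  "tangent_map z = blinfun_mult_right (deriv h z) + (Blinfun cnj o\<^sub>L blinfun_mult_right (deriv g z))"

lemma tangent_map_apply [simp]: "blinfun_apply (tangent_map z) v = deriv h z * v + cnj (deriv g z * v)"
  by (simp add: tangent_map_def blinfun.add_left bounded_linear_Blinfun_apply[OF bounded_linear_cnj])

lemma has_derivative_harmonic_map: "(harmonic_map has_derivative blinfun_apply (tangent_map z)) (at z)" if "z \<in> S"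
proof -
  have "(h has_derivative (\<lambda>v. deriv h z * v)) (at z)" "(g has_derivative (\<lambda>v. deriv g z * v)) (at z)"
    using holomorphic_derivI[OF holh open_S that] holomorphic_derivI[OF holg open_S that]
    by (auto simp: has_field_derivative_def)
  then have "((\<lambda>z. h z + cnj (g z)) has_derivative (\<lambda>v. deriv h z * v + cnj (deriv g z * v))) (at z)"
    by (intro has_derivative_add bounded_linear.has_derivative[OF bounded_linear_cnj])
  moreover have "harmonic_map = (\<lambda>z. h z + cnj (g z))" by (simp add: harmonic_map_def fun_eq_iff)
  moreover have "blinfun_apply (tangent_map z) = (\<lambda>v. deriv h z * v + cnj (deriv g z * v))"
    by (simp add: fun_eq_iff)
  ultimately show ?thesis by simp
qed

lemma continuous_on_harmonic_map: "continuous_on S harmonic_map"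
  by (intro continuous_at_imp_continuous_on ballI) (rule has_derivative_continuous[OF has_derivative_harmonic_map])

text \<open>
  The Jacobian is \<open>|h'|\<^sup>2 - |g'|\<^sup>2\<close>; the dilatation bound makes it positive.
\<close>

lemma inj_tangent_map: "inj (blinfun_apply (tangent_map z))" if "z \<in> S"
proof -
  have "v = 0" if "blinfun_apply (tangent_map z) v = 0" for v
  proof (rule ccontr)
    assume "v \<noteq> 0"
    from that have "deriv h z * v = - cnj (deriv g z * v)" by (simp add: add_eq_0_iff)
    then have "norm (deriv h z) * norm v = norm (deriv g z) * norm v"
      by (metis complex_mod_cnj norm_minus_cancel norm_mult)
    with dilatation[OF \<open>z \<in> S\<close>] \<open>v \<noteq> 0\<close> show False by simp
  qed
  then show ?thesis
    by (metis (no_types, lifting) blinfun.diff_right eq_iff_diff_eq_0 injI)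
qed

lemma local_inverse:
  assumes "z \<in> S" "open T" "z \<in> T" "T \<subseteq> S"
  obtains U V k where "open U" "U \<subseteq> T" "z \<in> U" "open V" "harmonic_map z \<in> V" "homeomorphism U V harmonic_map k"
    "(k has_derivative inv (blinfun_apply (tangent_map z))) (at (harmonic_map z))"
proof -
  have lin: "linear (blinfun_apply (tangent_map z))"
    by (simp add: blinfun.bounded_linear_right bounded_linear.linear)
  then obtain k' where k': "linear k'" "k' \<circ> blinfun_apply (tangent_map z) = id"
    using linear_injective_left_inverse[OF _ inj_tangent_map[OF assms(1)]] by auto
  have inv: "Blinfun k' o\<^sub>L tangent_map z = id_blinfun"
    using k' by (intro blinfun_eqI)
      (simp add: bounded_linear_Blinfun_apply linear_conv_bounded_linear[symmetric] pointfree_idE del: tangent_map_apply)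
  have cont: "continuous_on T tangent_map"
    unfolding tangent_map_def
    by (intro continuous_intros bounded_linear.continuous_on[OF bounded_linear_blinfun_mult_right]
        continuous_on_subset[OF holomorphic_on_imp_continuous_on[OF holomorphic_deriv[OF holh open_S]] assms(4)]
        continuous_on_subset[OF holomorphic_on_imp_continuous_on[OF holomorphic_deriv[OF holg open_S]] assms(4)])
  have der: "(harmonic_map has_derivative blinfun_apply (tangent_map x)) (at x)" if "x \<in> T" for x
    using has_derivative_harmonic_map that assms(4) by blast
  show ?thesis
  proof (rule inverse_function_theorem[OF assms(2) der cont assms(3) inv])
    fix U V k k''
    assume *: "open U" "U \<subseteq> T" "z \<in> U" "open V" "harmonic_map z \<in> V" "homeomorphism U V harmonic_map k"
      and k'': "\<And>y. y \<in> V \<Longrightarrow> (k has_derivative (k'' y)) (at y)"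
      "\<And>y. y \<in> V \<Longrightarrow> k'' y = inv (blinfun_apply (tangent_map (k y)))"
    have "k (harmonic_map z) = z" using homeomorphism_apply1[OF *(6,3)] .
    with k''(1)[OF *(5)] k''(2)[OF *(5)] have "(k has_derivative inv (blinfun_apply (tangent_map z))) (at (harmonic_map z))"
      by simp
    with * show thesis by (rule that)
  qed
qed

lemma open_map:
  assumes T: "open T" "T \<subseteq> S"
  shows "open (harmonic_map ` T)"
proof (rule openI)
  fix y assume "y \<in> harmonic_map ` T"
  then obtain z where z: "z \<in> T" "y = harmonic_map z" by blast
  obtain U V k where *: "open U" "U \<subseteq> T" "z \<in> U" "open V" "harmonic_map z \<in> V" "homeomorphism U V harmonic_map k"
    by (rule local_inverse[OF subsetD[OF T(2) z(1)] T(1) z(1) T(2)]) blast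
  have "V \<subseteq> harmonic_map ` T" using homeomorphism_image1[OF *(6)] *(2) by blast
  then show "\<exists>e>0. ball y e \<subseteq> harmonic_map ` T"
    using openE[OF *(4,5)] z(2) by (metis subset_trans)
qed

text \<open>
  Follow the preimage \<open>\<gamma>(s)\<close> of \<open>(1 - s) f(z)\<close> under the local inverse at \<open>z\<close>, and write
  \<open>\<gamma>'(0) = z \<eta>\<close>. Solving the linear equation for \<open>\<eta>\<close> shows that \<open>- Re \<eta>\<close> is the turning quantity
  divided by \<open>|z h'|\<^sup>2 - |z g'|\<^sup>2\<close>. So \<open>|\<gamma>|\<close> decreases exactly because \<open>arg f\<close> increases along the
  circle.
\<close>

lemma radial_contraction:
  assumes z: "z \<in> S" "z \<noteq> 0" "ball 0 (norm z) \<subseteq> S"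
    and turning: "Re ((z * deriv h z - cnj (z * deriv g z)) * cnj (harmonic_map z)) > 0"
  shows "eventually (\<lambda>s::real. of_real (1 - s) * harmonic_map z \<in> harmonic_map ` ball 0 (norm z)) (at_right 0)"
proof -
  obtain U V k where *: "open U" "U \<subseteq> S" "z \<in> U" "open V" "harmonic_map z \<in> V" "homeomorphism U V harmonic_map k"
    and der: "(k has_derivative inv (blinfun_apply (tangent_map z))) (at (harmonic_map z))"
    by (rule local_inverse[OF z(1) open_S z(1) order_refl]) blast
  have kz: "k (harmonic_map z) = z" using homeomorphism_apply1[OF *(6,3)] .
  have "surj (blinfun_apply (tangent_map z))"
    using linear_injective_imp_surjective[OF _ inj_tangent_map[OF z(1)]] blinfun.bounded_linear_right bounded_linear.linear
    by blast
  define v where "v = inv (blinfun_apply (tangent_map z)) (- harmonic_map z)"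
  have v: "deriv h z * v + cnj (deriv g z * v) = - harmonic_map z"
    using surj_f_inv_f[OF \<open>surj (blinfun_apply (tangent_map z))\<close>, of "- harmonic_map z"] by (simp add: v_def)
  have inner: "inner z v < 0"
  proof -
    define A B \<eta> where "A = z * deriv h z" and "B = z * deriv g z" and "\<eta> = v / z"
    have 1: "A * \<eta> + cnj (B * \<eta>) = - harmonic_map z" using v z(2) by (simp add: A_def B_def \<eta>_def)
    have 2: "cnj A * cnj \<eta> + B * \<eta> = - cnj (harmonic_map z)" using arg_cong[OF 1, of cnj] by simp
    have "cnj A * (A * \<eta> + cnj (B * \<eta>)) - cnj B * (cnj A * cnj \<eta> + B * \<eta>) = (A * cnj A - B * cnj B) * \<eta>"
      by (simp add: algebra_simps)
    also have "A * cnj A - B * cnj B = of_real ((norm A)\<^sup>2 - (norm B)\<^sup>2)"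
      using complex_norm_square[of A] complex_norm_square[of B] by simp
    finally have "of_real ((norm A)\<^sup>2 - (norm B)\<^sup>2) * \<eta> = - (cnj A * harmonic_map z - cnj B * cnj (harmonic_map z))"
      unfolding 1 2 by simp
    from arg_cong[OF this, of Re]
    have "((norm A)\<^sup>2 - (norm B)\<^sup>2) * Re \<eta> = - Re (cnj A * harmonic_map z - cnj B * cnj (harmonic_map z))"
      by (simp only: scaleR_conv_of_real[symmetric] scaleR_complex.sel uminus_complex.sel)
    also have "Re (cnj A * harmonic_map z - cnj B * cnj (harmonic_map z)) = Re ((A - cnj B) * cnj (harmonic_map z))"
      by (simp add: algebra_simps)
    finally have "((norm A)\<^sup>2 - (norm B)\<^sup>2) * Re \<eta> < 0"
      using turning by (simp add: A_def B_def)
    moreover have "norm B < norm A" using dilatation[OF z(1)] z(2) by (simp add: A_def B_def norm_mult)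
    then have "(norm A)\<^sup>2 - (norm B)\<^sup>2 > 0" by (simp add: power_strict_mono)
    ultimately have "Re \<eta> < 0" by (simp add: mult_less_0_iff)
    have "v = z * \<eta>" using z(2) by (simp add: \<eta>_def)
    then have "inner z v = ((Re z)\<^sup>2 + (Im z)\<^sup>2) * Re \<eta>"
      by (simp add: inner_complex_def power2_eq_square algebra_simps)
    then have "inner z v = (norm z)\<^sup>2 * Re \<eta>" by (simp only: cmod_power2)
    then show ?thesis using \<open>Re \<eta> < 0\<close> z(2) by (simp add: mult_pos_neg)
  qed
  have "((\<lambda>s::real. of_real (1 - s) * harmonic_map z) has_vector_derivative - harmonic_map z) (at 0)"
    by (auto intro!: derivative_eq_intros simp: has_vector_derivative_def scaleR_conv_of_real)
  then have "((\<lambda>s::real. k (of_real (1 - s) * harmonic_map z)) has_vector_derivative v) (at 0)"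
    using vector_derivative_diff_chain_within[of "\<lambda>s::real. of_real (1 - s) * harmonic_map z" "- harmonic_map z" 0 UNIV k] der
    by (auto simp: o_def v_def intro: has_derivative_at_withinI)
  from has_real_derivative_norm_squared[OF this]
  have "((\<lambda>s::real. (norm (k (of_real (1 - s) * harmonic_map z)))\<^sup>2) has_real_derivative 2 * inner z v) (at 0)"
    by (simp add: kz)
  then obtain d where d: "d > 0" "\<And>s. 0 < s \<Longrightarrow> s < d \<Longrightarrow>
      (norm (k (of_real (1 - (0 + s)) * harmonic_map z)))\<^sup>2 < (norm (k (of_real (1 - 0) * harmonic_map z)))\<^sup>2"
    using DERIV_neg_dec_right[of "\<lambda>s::real. (norm (k (of_real (1 - s) * harmonic_map z)))\<^sup>2" _ 0] inner by force
  have "((\<lambda>s::real. of_real (1 - s) * harmonic_map z) \<longlongrightarrow> of_real (1 - 0) * harmonic_map z) (at_right 0)"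
    by (intro tendsto_intros)
  then have "eventually (\<lambda>s::real. of_real (1 - s) * harmonic_map z \<in> V) (at_right 0)"
    using *(4,5) topological_tendstoD by fastforce
  moreover have "eventually (\<lambda>s::real. s \<in> {0<..<d}) (at_right 0)"
    using d(1) by (rule eventually_at_rightI[rotated]) 
  ultimately show ?thesis
  proof eventually_elim
    case (elim s)
    then have "(norm (k (of_real (1 - s) * harmonic_map z)))\<^sup>2 < (norm z)\<^sup>2" using d(2)[of s] kz by simp
    then have "norm (k (of_real (1 - s) * harmonic_map z)) < norm z" by (rule power2_less_imp_less) simp
    moreover have "harmonic_map (k (of_real (1 - s) * harmonic_map z)) = of_real (1 - s) * harmonic_map z"
      using homeomorphism_apply2[OF *(6) elim(1)] .
    ultimately show ?case by (metis image_eqI mem_ball_0)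
  qed
qed

text \<open>
  Suppose \<open>t f(z)\<close> has no preimage in the compact disc \<open>D\<close> of radius \<open>|z|\<close>, and let \<open>u\<close> be the least number
  above \<open>t\<close> for which \<open>u f(z)\<close> has one. At this preimage \<open>radial_contraction\<close> produces preimages
  in \<open>D\<close> for numbers slightly below \<open>u\<close>.
\<close>

lemma starlike_image:
  assumes S: "ball 0 \<rho> \<subseteq> S" and f0: "harmonic_map 0 = 0"
    and turning: "\<And>z. z \<noteq> 0 \<Longrightarrow> norm z < \<rho> \<Longrightarrow> Re ((z * deriv h z - cnj (z * deriv g z)) * cnj (harmonic_map z)) > 0"
    and r: "0 < r" "r \<le> \<rho>"
  shows "starlike_domain_wrt 0 (harmonic_map ` ball 0 r)"
proof -
  have sub: "ball 0 r \<subseteq> S" using S r by auto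
  have seg: "of_real t * harmonic_map z \<in> harmonic_map ` cball 0 (norm z)" if z: "norm z < r" and t: "0 \<le> t" "t \<le> 1" for z and t :: real
  proof (rule ccontr)
    assume not: "of_real t * harmonic_map z \<notin> harmonic_map ` cball 0 (norm z)"
    have fz: "harmonic_map z \<noteq> 0"
    proof
      assume "harmonic_map z = 0"
      then have "of_real t * harmonic_map z = harmonic_map 0" by (simp add: f0)
      with not show False by auto
    qed
    define D where "D = cball (0::complex) (norm z)"
    have "D \<subseteq> S" using z sub by (auto simp: D_def)
    then have "compact (harmonic_map ` D)"
      by (intro compact_continuous_image continuous_on_subset[OF continuous_on_harmonic_map]) (auto simp: D_def)
    define A where "A = {u \<in> {t..1}. of_real u * harmonic_map z \<in> harmonic_map ` D}"
    have "closed ({t..1} \<inter> (\<lambda>u. of_real u * harmonic_map z) -` (harmonic_map ` D))"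
      by (intro continuous_closed_preimage continuous_intros compact_imp_closed[OF \<open>compact (harmonic_map ` D)\<close>])
    moreover have "A = {t..1} \<inter> (\<lambda>u. of_real u * harmonic_map z) -` (harmonic_map ` D)" by (auto simp: A_def)
    ultimately have "closed A" by simp
    have "1 \<in> A" using t by (auto simp: A_def D_def)
    have bdd: "bdd_below A" by (auto simp: A_def)
    define u where "u = Inf A"
    have "u \<in> A" unfolding u_def using \<open>closed A\<close> \<open>1 \<in> A\<close> bdd by (intro closed_contains_Inf) auto
    then obtain x where x: "x \<in> D" "of_real u * harmonic_map z = harmonic_map x" and u: "t \<le> u" "u \<le> 1" by (auto simp: A_def)
    have "u \<noteq> t" using not \<open>u \<in> A\<close> by (auto simp: A_def D_def)
    with u t have "t < u" "0 < u" by auto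
    have "x \<noteq> 0" using x(2) f0 fz \<open>0 < u\<close> by auto
    have xz: "norm x \<le> norm z" using x by (auto simp: D_def)
    have "eventually (\<lambda>s::real. of_real (1 - s) * harmonic_map x \<in> harmonic_map ` ball 0 (norm x)) (at_right 0)"
    proof (rule radial_contraction[OF _ \<open>x \<noteq> 0\<close>])
      show "x \<in> S" "ball 0 (norm x) \<subseteq> S" using sub xz z by auto
      show "Re ((x * deriv h x - cnj (x * deriv g x)) * cnj (harmonic_map x)) > 0"
        using turning[OF \<open>x \<noteq> 0\<close>] xz z r by auto
    qed
    moreover have "eventually (\<lambda>s::real. s \<in> {0<..<(u - t) / u}) (at_right 0)"
      using \<open>t < u\<close> \<open>0 < u\<close> by (intro eventually_at_rightI[rotated]) auto
    ultimately have "eventually (\<lambda>s::real. False) (at_right 0)"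
    proof eventually_elim
      case (elim s)
      have "of_real ((1 - s) * u) * harmonic_map z \<in> harmonic_map ` ball 0 (norm x)"
        using elim(1) x(2) by (simp add: mult.assoc)
      moreover have "harmonic_map ` ball 0 (norm x) \<subseteq> harmonic_map ` D" using xz by (auto simp: D_def)
      moreover have "t \<le> (1 - s) * u" "(1 - s) * u < u"
        using elim(2) \<open>0 < u\<close> by (auto simp: field_simps)
      ultimately have "(1 - s) * u \<in> A" using u by (auto simp: A_def)
      then have "u \<le> (1 - s) * u" unfolding u_def using bdd by (intro cInf_lower)
      then show False using \<open>(1 - s) * u < u\<close> by simp
    qed
    then show False by simp
  qed
  have "closed_segment 0 (harmonic_map z) \<subseteq> harmonic_map ` ball 0 r" if "norm z < r" for z
  proof
    fix y assume "y \<in> closed_segment 0 (harmonic_map z)"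
    then obtain t where t: "0 \<le> t" "t \<le> 1" "y = of_real t * harmonic_map z"
      by (auto simp: in_segment scaleR_conv_of_real)
    then have "y \<in> harmonic_map ` cball 0 (norm z)" using seg[OF that t(1,2)] by simp
    then show "y \<in> harmonic_map ` ball 0 r" using that by auto
  qed
  moreover have "open (harmonic_map ` ball 0 r)" by (rule open_map[OF open_ball sub])
  moreover have "connected (harmonic_map ` ball 0 r)"
    by (intro connected_continuous_image continuous_on_subset[OF continuous_on_harmonic_map sub] connected_ball)
  moreover have "0 \<in> harmonic_map ` ball 0 r" using f0 r by (metis centre_in_ball image_eqI)
  ultimately show ?thesis by (auto simp: starlike_domain_wrt_def)
qed

end

section \<open>The lower bound\<close>

lemma holomorphic_cube_root_ball:
  assumes holF: "F holomorphic_on ball 0 1" and nz: "\<And>z. norm z < 1 \<Longrightarrow> F z \<noteq> 0"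
  obtains p where "p holomorphic_on ball 0 1" "\<And>z. norm z < 1 \<Longrightarrow> p z ^ 3 = F z"
    "\<And>z. norm z < 1 \<Longrightarrow> p z \<noteq> 0"
    "\<And>z. norm z < 1 \<Longrightarrow> deriv p z / p z = deriv F z / F z / 3"
proof -
  have "contractible (ball (0::complex) 1)" by (simp add: convex_imp_contractible)
  then obtain k where holk: "k holomorphic_on ball 0 1" and k: "\<And>z. z \<in> ball 0 1 \<Longrightarrow> F z = exp (k z)"
    using contractible_imp_holomorphic_log[OF holF] nz by (metis mem_ball_0)
  define p where "p \<equiv> \<lambda>z. exp (k z / 3)"
  show thesis
  proof (rule that[of p])
    show "p holomorphic_on ball 0 1" unfolding p_def by (intro holomorphic_intros holk) auto
    show "p z \<noteq> 0" for z by (simp add: p_def)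
    show "p z ^ 3 = F z" if "norm z < 1" for z
      using that by (simp add: p_def k exp_of_nat_mult[symmetric])
    show "deriv p z / p z = deriv F z / F z / 3" if z: "norm z < 1" for z
    proof -
      have dk: "(k has_field_derivative deriv k z) (at z)"
        using z by (intro holomorphic_derivI[OF holk open_ball]) auto
      have "deriv p z = p z * (deriv k z / 3)"
        unfolding p_def by (rule DERIV_imp_deriv) (auto intro!: derivative_eq_intros dk)
      moreover have "((\<lambda>z. exp (k z)) has_field_derivative F z * deriv k z) (at z)"
        using z by (auto intro!: derivative_eq_intros dk simp: k)
      then have "(F has_field_derivative F z * deriv k z) (at z)"
        by (rule has_field_derivative_transform_within_open[OF _ open_ball[of 0 1]]) (use z k in auto)
      then have "deriv F z = F z * deriv k z" by (rule DERIV_imp_deriv)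
      ultimately show ?thesis using nz[OF z] by (simp add: p_def)
    qed
  qed
qed

lemma M1_starlike_image:
  assumes f: "f \<in> M1" and r: "0 < r" "r \<le> 4 * sqrt 2 - 5"
  shows "starlike_domain_wrt 0 (f ` ball 0 r)"
proof -
  obtain h g a b where holh: "h holomorphic_on ball 0 1" and holg: "g holomorphic_on ball 0 1"
    and a: "a (0::nat) = 0" "\<forall>z\<in>ball 0 1. (\<lambda>n. a n * z ^ n) sums h z"
    and b: "b (0::nat) = 0" "\<forall>z\<in>ball 0 1. (\<lambda>n. b n * z ^ n) sums g z"
    and f_eq: "\<forall>z\<in>ball 0 1. f z = h z + cnj (g z)"
    and dg: "\<forall>z\<in>ball 0 1. deriv g z = z * deriv h z"
    and dh: "\<forall>z\<in>ball 0 1. deriv h z \<noteq> 0 \<and> Re (1 + z * deriv (deriv h) z / deriv h z) > - (1 / 2)"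
    using f unfolding M1_def by blast
  have h0: "h 0 = 0" and g0: "g 0 = 0"
    using sums_unique2[OF powser_sums_zero[of a] bspec[OF a(2), of 0]]
      sums_unique2[OF powser_sums_zero[of b] bspec[OF b(2), of 0]] a(1) b(1) by auto
  have "sqrt 2 < 3 / 2" by (rule real_less_lsqrt) (auto simp: power2_eq_square)
  then have rad1: "4 * sqrt 2 - 5 < 1" by simp
  interpret H: sense_preserving_harmonic h g "ball 0 1"
  proof
    show "norm (deriv g z) < norm (deriv h z)" if "z \<in> ball 0 1" for z
      using that dg dh by (simp add: norm_mult)
  qed (use holh holg in auto)
  obtain p where holp: "p holomorphic_on ball 0 1" and p3: "\<And>z. norm z < 1 \<Longrightarrow> p z ^ 3 = deriv h z"
    and pnz: "\<And>z. norm z < 1 \<Longrightarrow> p z \<noteq> 0"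
    and logp: "\<And>z. norm z < 1 \<Longrightarrow> deriv p z / p z = deriv (deriv h) z / deriv h z / 3"
    by (rule holomorphic_cube_root_ball[OF holomorphic_deriv[OF holh open_ball]]) (use dh in auto)
  have Re_p: "Re (z * (deriv p z / p z)) > - 1 / 2" if "norm z < 1" for z
  proof -
    have "z * (deriv p z / p z) = (z * deriv (deriv h) z / deriv h z) / 3"
      by (simp add: logp[OF that])
    then have "Re (z * (deriv p z / p z)) = Re (z * deriv (deriv h) z / deriv h z) / 3"
      by (simp only: Re_divide_numeral)
    moreover have "Re (1 + z * deriv (deriv h) z / deriv h z) > - (1 / 2)" using dh that by simp
    then have "1 + Re (z * deriv (deriv h) z / deriv h z) > - (1 / 2)"
      by (simp only: plus_complex.sel one_complex.sel)
    ultimately show ?thesis by linarith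
  qed
  have "starlike_domain_wrt 0 (H.harmonic_map ` ball 0 r)"
  proof (rule H.starlike_image[OF _ _ _ r])
    show "ball 0 (4 * sqrt 2 - 5) \<subseteq> ball (0::complex) 1" using rad1 by auto
    show "H.harmonic_map 0 = 0" by (simp add: H.harmonic_map_def h0 g0)
    fix z :: complex assume z: "z \<noteq> 0" "norm z < 4 * sqrt 2 - 5"
    then have z1: "norm z < 1" using rad1 by linarith
    have "Re ((z * deriv h z - cnj (z * deriv g z)) * cnj (h z + cnj (g z))) > 0"
    proof (rule Re_harmonic_angular_derivative_pos)
      fix \<epsilon> :: complex assume \<epsilon>: "norm \<epsilon> \<le> 1"
      have "Re ((h z + \<epsilon> * g z) / (z * ((1 + \<epsilon> * z) * p z ^ 3))) > 0"
      proof (rule starlike_radius_analytic[OF holp pnz Re_p \<epsilon> _ _ z, of "\<lambda>z. h z + \<epsilon> * g z"])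
        show "((\<lambda>z. h z + \<epsilon> * g z) has_field_derivative (1 + \<epsilon> * w) * p w ^ 3) (at w)" if w: "norm w < 1" for w
        proof -
          have "(h has_field_derivative deriv h w) (at w)" "(g has_field_derivative deriv g w) (at w)"
            using w by (auto intro!: holomorphic_derivI[OF holh open_ball] holomorphic_derivI[OF holg open_ball])
          then have "((\<lambda>z. h z + \<epsilon> * g z) has_field_derivative deriv h w + \<epsilon> * deriv g w) (at w)"
            by (auto intro!: derivative_eq_intros)
          then show ?thesis using w dg by (simp add: p3 algebra_simps)
        qed
      qed (auto simp: h0 g0)
      moreover have "z * ((1 + \<epsilon> * z) * p z ^ 3) = z * deriv h z + \<epsilon> * (z * deriv g z)"
        using z1 dg by (simp add: p3 algebra_simps)
      ultimately have "Re ((h z + \<epsilon> * g z) * cnj (z * deriv h z + \<epsilon> * (z * deriv g z))) > 0"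
        by (simp only: Re_complex_div_gt_0)
      then have "Re (cnj ((h z + \<epsilon> * g z) * cnj (z * deriv h z + \<epsilon> * (z * deriv g z)))) > 0"
        by (simp only: cnj.sel)
      then show "Re ((z * deriv h z + \<epsilon> * (z * deriv g z)) * cnj (h z + \<epsilon> * g z)) > 0"
        by (simp only: complex_cnj_mult complex_cnj_cnj mult.commute)
    qed
    then show "Re ((z * deriv h z - cnj (z * deriv g z)) * cnj (H.harmonic_map z)) > 0"
      by (simp add: H.harmonic_map_def)
  qed
  moreover have "f ` ball 0 r = H.harmonic_map ` ball 0 r"
    using f_eq r rad1 by (intro image_cong) (auto simp: H.harmonic_map_def)
  ultimately show ?thesis by simp
qed

text \<open>
  Each segment to be contained in the large image lies already in the image of a smaller ball.
\<close>

lemma starlike_domain_wrt_increasing_balls: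
  assumes s: "0 < s" and star: "\<And>r. 0 < r \<Longrightarrow> r < s \<Longrightarrow> starlike_domain_wrt 0 (f ` ball (0::complex) r)"
  shows "starlike_domain_wrt 0 (f ` ball 0 s)"
proof -
  have seg: "closed_segment 0 w \<subseteq> f ` ball 0 s" if w: "w \<in> f ` ball 0 s" for w
  proof -
    obtain z where z: "w = f z" "norm z < s" using w by auto
    obtain r where r: "norm z < r" "r < s" using dense[OF z(2)] by blast
    then have "0 < r" using norm_ge_zero[of z] by linarith
    from star[OF this r(2)] have "closed_segment 0 w \<subseteq> f ` ball 0 r"
      using r z by (auto simp: starlike_domain_wrt_def)
    then show ?thesis using r by force
  qed
  have "0 \<in> f ` ball 0 (s / 2)" using star[of "s / 2"] s by (simp add: starlike_domain_wrt_def)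
  then have zero: "0 \<in> f ` ball 0 s" using s by force
  have "f ` ball 0 s = (\<Union>r\<in>{0<..<s}. f ` ball 0 r)"
  proof
    show "f ` ball 0 s \<subseteq> (\<Union>r\<in>{0<..<s}. f ` ball 0 r)"
    proof
      fix w assume "w \<in> f ` ball 0 s"
      then obtain z where z: "w = f z" "norm z < s" by auto
      obtain r where r: "norm z < r" "r < s" using dense[OF z(2)] by blast
      then have "0 < r" using norm_ge_zero[of z] by linarith
      with r z show "w \<in> (\<Union>r\<in>{0<..<s}. f ` ball 0 r)" by force
    qed
    show "(\<Union>r\<in>{0<..<s}. f ` ball 0 r) \<subseteq> f ` ball 0 s" by force
  qed
  then have "open (f ` ball 0 s)" using star by (auto simp: starlike_domain_wrt_def)
  moreover have "connected (f ` ball 0 s)"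
  proof (rule starlike_imp_connected)
    show "starlike (f ` ball 0 s)" unfolding starlike_def using zero seg by blast
  qed
  ultimately show ?thesis using seg zero by (auto simp: starlike_domain_wrt_def)
qed

text \<open>
  The \<open>GREATEST\<close> in the definition is meaningful only if the supremum of the admissible radii is itself
  admissible; one admissible radius is needed to have a nonempty set.
\<close>

lemma radius_of_starlikeness_attained:
  assumes \<rho>: "0 < \<rho>" "\<rho> \<le> 1"
    and star: "\<And>r f. 0 < r \<Longrightarrow> r \<le> \<rho> \<Longrightarrow> f \<in> F \<Longrightarrow> starlike_domain_wrt 0 (f ` ball 0 r)"
  defines "R \<equiv> radius_of_starlikeness F"
  shows "\<rho> \<le> R" and "R \<le> 1"
    and "\<And>r f. 0 < r \<Longrightarrow> r \<le> R \<Longrightarrow> f \<in> F \<Longrightarrow> starlike_domain_wrt 0 (f ` ball 0 r)"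
proof -
  define P where "P \<equiv> \<lambda>r0. 0 < r0 \<and> r0 \<le> 1 \<and>
     (\<forall>r. 0 < r \<and> r \<le> r0 \<longrightarrow> (\<forall>f\<in>F. starlike_domain_wrt 0 (f ` ball 0 r)))"
  define s where "s = Sup {r. P r}"
  have P\<rho>: "P \<rho>" using \<rho> star by (auto simp: P_def)
  have bdd: "bdd_above {r. P r}" by (auto simp: P_def)
  have le: "r \<le> s" if "P r" for r unfolding s_def using that bdd by (intro cSup_upper) auto
  have "s \<le> 1" unfolding s_def using P\<rho> by (intro cSup_least) (auto simp: P_def)
  have s0: "0 < s" using le[OF P\<rho>] \<rho> by linarith
  have below: "starlike_domain_wrt 0 (f ` ball 0 r)" if r: "0 < r" "r < s" "f \<in> F" for r f
  proof -
    obtain r0 where "P r0" "r < r0"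
      using r(2) P\<rho> bdd unfolding s_def by (subst (asm) less_cSup_iff) auto
    then show ?thesis using r by (auto simp: P_def)
  qed
  have "starlike_domain_wrt 0 (f ` ball 0 r)" if "0 < r" "r \<le> s" "f \<in> F" for r f
    using starlike_domain_wrt_increasing_balls[OF s0 below] below that by (cases "r = s") auto
  then have "P s" using s0 \<open>s \<le> 1\<close> by (auto simp: P_def)
  then have "R = s"
    unfolding R_def radius_of_starlikeness_def P_def[symmetric] by (intro Greatest_equality le)
  with \<open>P s\<close> le[OF P\<rho>] show "\<rho> \<le> R" "R \<le> 1"
    "\<And>r f. 0 < r \<Longrightarrow> r \<le> R \<Longrightarrow> f \<in> F \<Longrightarrow> starlike_domain_wrt 0 (f ` ball 0 r)"
    by (auto simp: P_def)
qed

section \<open>A member whose larger images are not starlike\<close>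

text \<open>
  The harmonic function \<open>h + cnj g\<close> with \<open>h' = 1 / (1 - z)\<^sup>3\<close> and \<open>g' = z h'\<close>, written in terms of
  \<open>\<zeta> = 1 / (1 - z)\<close>.
\<close>

definition M1_example :: "complex \<Rightarrow> complex" where
  "M1_example z = ((1 / (1 - z))\<^sup>2 - 1) / 2 + cnj ((1 / (1 - z) - 1)\<^sup>2 / 2)"

lemma M1_example_in_M1: "M1_example \<in> M1"
proof -
  define h g :: "complex \<Rightarrow> complex"
    where "h = (\<lambda>z. ((1 / (1 - z))\<^sup>2 - 1) / 2)" and "g = (\<lambda>z. (1 / (1 - z) - 1)\<^sup>2 / 2)"
  have nz: "1 - z \<noteq> 0" if "norm z < 1" for z :: complex
    using that by auto
  have hol: "h holomorphic_on ball 0 1" "g holomorphic_on ball 0 1"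
    unfolding h_def g_def by (intro holomorphic_intros; use nz in force)+
  have der_inv: "((\<lambda>z. 1 / (1 - z)) has_field_derivative (1 / (1 - z))\<^sup>2) (at z)" if "norm z < 1" for z :: complex
    using nz[OF that] by (auto intro!: derivative_eq_intros simp: power2_eq_square)
  have half_square: "((\<lambda>z. ((k z)\<^sup>2 - 1) / 2) has_field_derivative k z * k') (at z)"
    and half_shifted_square: "((\<lambda>z. (k z - 1)\<^sup>2 / 2) has_field_derivative (k z - 1) * k') (at z)"
    and cube: "((\<lambda>z. k z ^ 3) has_field_derivative 3 * ((k z)\<^sup>2 * k')) (at z)"
    if "(k has_field_derivative k') (at z)" for k :: "complex \<Rightarrow> complex" and k' z
    by (auto intro!: derivative_eq_intros that)
  have dh: "deriv h z = (1 / (1 - z)) ^ 3" and dg: "deriv g z = z * (1 / (1 - z)) ^ 3" if "norm z < 1" for z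
  proof -
    have "(h has_field_derivative (1 / (1 - z)) * (1 / (1 - z))\<^sup>2) (at z)"
      unfolding h_def by (rule half_square[OF der_inv[OF that]])
    moreover have "(1 / (1 - z)) * (1 / (1 - z))\<^sup>2 = (1 / (1 - z)) ^ 3"
      by (simp only: power2_eq_square power3_eq_cube mult.assoc)
    ultimately show "deriv h z = (1 / (1 - z)) ^ 3" by (simp only: DERIV_imp_deriv)
    have "(g has_field_derivative (1 / (1 - z) - 1) * (1 / (1 - z))\<^sup>2) (at z)"
      unfolding g_def by (rule half_shifted_square[OF der_inv[OF that]])
    moreover have "(1 / (1 - z) - 1) * (1 / (1 - z))\<^sup>2 = z * (1 / (1 - z)) ^ 3"
      using nz[OF that] by (simp add: field_simps power2_eq_square power3_eq_cube)
    ultimately show "deriv g z = z * (1 / (1 - z)) ^ 3" by (simp only: DERIV_imp_deriv)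
  qed
  have ddh: "deriv (deriv h) z = 3 * (1 / (1 - z)) ^ 4" if z: "norm z < 1" for z
  proof -
    have "((\<lambda>z. (1 / (1 - z)) ^ 3) has_field_derivative 3 * (1 / (1 - z)) ^ 4) (at z)"
      using cube[OF der_inv[OF z]] by (simp only: power_add[symmetric]) simp
    then have "(deriv h has_field_derivative 3 * (1 / (1 - z)) ^ 4) (at z)"
      by (rule has_field_derivative_transform_within_open[OF _ open_ball[of 0 1]]) (use z dh in auto)
    then show ?thesis by (rule DERIV_imp_deriv)
  qed
  have Re_pos: "Re (1 + z * deriv (deriv h) z / deriv h z) > - (1 / 2)" if z: "norm z < 1" for z
  proof -
    have "norm (z / (1 - z)) < norm (1 + z / (1 - z))"
      using nz[OF z] z by (simp add: norm_divide divide_simps)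
    then have "Re (z / (1 - z)) > - 1 / 2" using norm_less_norm_one_plus_iff by blast
    moreover have "1 + z * deriv (deriv h) z / deriv h z = 1 + of_real 3 * (z / (1 - z))"
      using nz[OF z] by (simp add: ddh[OF z] dh[OF z] eval_nat_numeral)
    then have "Re (1 + z * deriv (deriv h) z / deriv h z) = 1 + 3 * Re (z / (1 - z))"
      by (simp only: plus_complex.sel one_complex.sel scaleR_conv_of_real[symmetric] scaleR_complex.sel)
    ultimately show ?thesis by simp
  qed
  define a b where "a = (\<lambda>n. (deriv ^^ n) h 0 / fact n)" and "b = (\<lambda>n. (deriv ^^ n) g 0 / fact n)"
  show ?thesis
    unfolding M1_def mem_Collect_eq
  proof (intro exI conjI ballI)
    show "a 0 = 0" by (simp add: a_def h_def)
    show "a 1 = 1" by (simp add: a_def dh)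
    show "b 0 = 0" by (simp add: b_def g_def)
    show "(\<lambda>n. a n * z ^ n) sums h z" if "z \<in> ball 0 1" for z
      using holomorphic_power_series[OF hol(1) that] by (simp add: a_def)
    show "(\<lambda>n. b n * z ^ n) sums g z" if "z \<in> ball 0 1" for z
      using holomorphic_power_series[OF hol(2) that] by (simp add: b_def)
    show "M1_example z = h z + cnj (g z)" for z by (simp add: M1_example_def h_def g_def)
    show "deriv g z = z * deriv h z" if "z \<in> ball 0 1" for z using that by (simp add: dh dg)
    show "deriv h z \<noteq> 0" if "z \<in> ball 0 1" for z using that nz[of z] by (simp add: dh)
    show "Re (1 + z * deriv (deriv h) z / deriv h z) > - (1 / 2)" if "z \<in> ball 0 1" for z
      using that Re_pos by simp
  qed (use hol in auto)
qed

lemma M1_example_half_plane: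
  "M1_example z = Complex ((Re (1 / (1 - z)))\<^sup>2 - Re (1 / (1 - z)) - (Im (1 / (1 - z)))\<^sup>2) (Im (1 / (1 - z)))"
proof -
  define \<zeta> where "\<zeta> = 1 / (1 - z)"
  have "(\<zeta>\<^sup>2 - 1) / 2 + cnj ((\<zeta> - 1)\<^sup>2 / 2) = Complex ((Re \<zeta>)\<^sup>2 - Re \<zeta> - (Im \<zeta>)\<^sup>2) (Im \<zeta>)"
    by (simp add: complex_eq_iff power2_eq_square field_simps)
  then show ?thesis by (simp add: M1_example_def \<zeta>_def)
qed

text \<open>
  The image of the disc of radius \<open>r\<close> under \<open>z \<mapsto> 1 / (1 - z)\<close> is a disc, given here by its quadratic
  equation, in the half plane to the right of \<open>1/2\<close>.
\<close>

lemma cball_half_plane: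
  assumes "norm z \<le> r" "r < 1"
  defines "\<zeta> \<equiv> 1 / (1 - z)"
  shows "(1 - r\<^sup>2) * ((Re \<zeta>)\<^sup>2 + (Im \<zeta>)\<^sup>2) - 2 * Re \<zeta> + 1 \<le> 0" and "Re \<zeta> > 1 / 2"
proof -
  have nz: "1 - z \<noteq> 0" using assms by auto
  then have "\<zeta> \<noteq> 0" and z: "\<zeta> - 1 = z * \<zeta>" by (auto simp: \<zeta>_def field_simps)
  have "norm (\<zeta> - 1) \<le> r * norm \<zeta>" unfolding z norm_mult using assms by (intro mult_right_mono) auto
  then have "(norm (\<zeta> - 1))\<^sup>2 \<le> (r * norm \<zeta>)\<^sup>2" by (intro power_mono) auto
  then show *: "(1 - r\<^sup>2) * ((Re \<zeta>)\<^sup>2 + (Im \<zeta>)\<^sup>2) - 2 * Re \<zeta> + 1 \<le> 0"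
    unfolding power_mult_distrib cmod_power2 by (simp add: power2_eq_square algebra_simps)
  have "r \<ge> 0" using assms norm_ge_zero[of z] by linarith
  then have "1 - r\<^sup>2 > 0" using assms by (simp add: abs_square_less_1)
  moreover have "(Re \<zeta>)\<^sup>2 + (Im \<zeta>)\<^sup>2 > 0" using \<open>\<zeta> \<noteq> 0\<close> by (simp add: complex_neq_0)
  ultimately have "(1 - r\<^sup>2) * ((Re \<zeta>)\<^sup>2 + (Im \<zeta>)\<^sup>2) > 0" by simp
  then show "Re \<zeta> > 1 / 2" using * by linarith
qed

text \<open>
  Suppose the image is starlike, and let \<open>z\<close> be a point on the circle \<open>|z| = r\<close>. By continuity the
  points \<open>t f(z)\<close> with \<open>0 \<le> t \<le> 1\<close> have preimages in the closed disc. In the coordinate \<open>\<zeta>\<close> these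
  preimages are \<open>\<xi>(t) + i t Y\<close>, and \<open>Q(t) \<le> 0\<close> says that they lie in the closed disc. As \<open>Q(1) = 0\<close>, this
  is violated once \<open>Q'(1) < 0\<close>.

  In the \<open>\<zeta>\<close>-plane the disc has centre \<open>c = 1 / (1 - r\<^sup>2)\<close>. For \<open>X = c - d\<close> on its boundary, \<open>c Q'(1) / 2\<close>
  times the positive number \<open>2 X - 1\<close> is a cubic in \<open>d\<close>, which is least for \<open>3 d\<^sup>2 = 2 c (c - 1)\<close>.
  With this \<open>d\<close> it equals \<open>- d\<^sup>2 (4 d - 3 c + 3/2)\<close>. That is negative when \<open>(c - 1/2)\<^sup>2 > 8/5\<close>, which is
  the condition on \<open>r\<close>.
\<close>

lemma M1_example_not_starlike:
  assumes r: "1 / 3 * sqrt (1 / 3 * (37 - 8 * sqrt 10)) < r" "r < 1"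
  shows "\<not> starlike_domain_wrt 0 (M1_example ` ball 0 r)"
proof
  assume star: "starlike_domain_wrt 0 (M1_example ` ball 0 r)"
  have s10: "sqrt 10 * sqrt 10 = 10" by simp
  have "sqrt 10 < 4" by (rule real_less_lsqrt) auto
  have "3 < sqrt 10" by (rule real_less_rsqrt) auto
  have r0: "0 < r" using r(1) \<open>sqrt 10 < 4\<close>
    by (smt (verit) real_sqrt_ge_zero zero_le_mult_iff divide_nonneg_nonneg)
  have r2: "(37 - 8 * sqrt 10) / 27 < r\<^sup>2"
  proof -
    have "(1 / 3 * sqrt (1 / 3 * (37 - 8 * sqrt 10)))\<^sup>2 < r\<^sup>2"
      using r \<open>sqrt 10 < 4\<close> by (intro power_strict_mono) auto
    then show ?thesis using \<open>sqrt 10 < 4\<close> by (simp add: power_mult_distrib power_divide)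
  qed
  have r21: "r\<^sup>2 < 1" using r0 r by (simp add: abs_square_less_1)
  define c where "c = 1 / (1 - r\<^sup>2)"
  have c1: "c > 1" and rc: "1 - r\<^sup>2 = 1 / c" using r0 r21 by (auto simp: c_def field_simps)
  have c_lower: "c > 1 / 2 + 2 * sqrt 10 / 5"
  proof -
    have "1 / c < (8 * sqrt 10 - 10) / 27" using r2 rc by (simp add: field_simps)
    then have "27 < (8 * sqrt 10 - 10) * c" using c1 by (simp add: field_simps)
    moreover have "(8 * sqrt 10 - 10) * (1 / 2 + 2 * sqrt 10 / 5) = 27"
      using s10 by (simp add: field_simps)
    ultimately have "(8 * sqrt 10 - 10) * (1 / 2 + 2 * sqrt 10 / 5) < (8 * sqrt 10 - 10) * c" by simp
    then show ?thesis using \<open>3 < sqrt 10\<close> by (subst (asm) mult_less_cancel_left_pos) auto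
  qed
  define d where "d = sqrt (2 * c * (c - 1) / 3)"
  have d2: "3 * d\<^sup>2 = 2 * c * (c - 1)" and d0: "d > 0" using c1 by (auto simp: d_def)
  have d_lower: "3 * c - 3 / 2 < 4 * d"
  proof -
    have "8 / 5 = (2 * sqrt 10 / 5)\<^sup>2" using s10 by (simp add: power2_eq_square)
    also have "\<dots> < (c - 1 / 2)\<^sup>2" using c_lower by (intro power_strict_mono) auto
    finally have "(3 * c - 3 / 2)\<^sup>2 < (4 * d)\<^sup>2"
      using d2 by (simp add: power2_eq_square algebra_simps)
    then show ?thesis by (rule power2_less_imp_less) (use d0 in auto)
  qed
  have d_upper: "d < c - 1 / 2"
  proof -
    have "d\<^sup>2 < (c - 1 / 2)\<^sup>2"
    proof -
      have "0 < (c - 1 / 2)\<^sup>2 + 1 / 2" by (rule add_nonneg_pos) auto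
      then show ?thesis using d2 by (simp add: power2_eq_square algebra_simps)
    qed
    then show ?thesis by (rule power2_less_imp_less) (use c1 in auto)
  qed
  define X Y where "X = c - d" and "Y = d / sqrt 2"
  have Y2: "Y\<^sup>2 = d\<^sup>2 / 2" by (simp add: Y_def power_divide)
  have X: "X > 1 / 2" using d_upper by (simp add: X_def)
  have circle: "X\<^sup>2 + Y\<^sup>2 = c * (2 * X - 1)"
    using d2 unfolding Y2 by (simp add: X_def power2_eq_square field_simps)
  define \<zeta> where "\<zeta> = Complex X Y"
  define z where "z = 1 - 1 / \<zeta>"
  have "\<zeta> \<noteq> 0" using X by (auto simp: \<zeta>_def complex_eq_iff)
  then have \<zeta>: "1 / (1 - z) = \<zeta>" by (simp add: z_def)
  have nz: "norm z = r"
  proof -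
    have "(norm (\<zeta> - 1))\<^sup>2 = (X\<^sup>2 + Y\<^sup>2) - (2 * X - 1)"
      unfolding cmod_power2 by (simp add: \<zeta>_def power2_eq_square algebra_simps)
    also have "2 * X - 1 = (1 - r\<^sup>2) * (X\<^sup>2 + Y\<^sup>2)" using c1 by (simp add: rc circle)
    finally have "(norm (\<zeta> - 1))\<^sup>2 = (r * norm \<zeta>)\<^sup>2"
      unfolding power_mult_distrib cmod_power2[of \<zeta>] by (simp add: \<zeta>_def algebra_simps)
    then have "norm (\<zeta> - 1) = r * norm \<zeta>"
      using r0 by (subst (asm) power2_eq_iff_nonneg) auto
    moreover have "z = (\<zeta> - 1) / \<zeta>" using \<open>\<zeta> \<noteq> 0\<close> by (simp add: z_def field_simps)
    ultimately show ?thesis using \<open>\<zeta> \<noteq> 0\<close> by (simp add: norm_divide)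
  qed
  define p where "p = X\<^sup>2 - X - Y\<^sup>2"
  have fz: "M1_example z = Complex p Y"
    unfolding M1_example_half_plane \<zeta> by (simp add: \<zeta>_def p_def)
  define \<xi> where "\<xi> \<equiv> \<lambda>t::real. 1 / 2 + sqrt (1 / 4 + t * p + (t * Y)\<^sup>2)"
  define Q where "Q \<equiv> \<lambda>t::real. (1 - r\<^sup>2) * ((\<xi> t)\<^sup>2 + (t * Y)\<^sup>2) - 2 * \<xi> t + 1"
  have cont: "continuous_on (cball 0 r) M1_example"
    unfolding M1_example_def by (intro continuous_intros) (use r in auto)
  have Q_le: "Q t \<le> 0" if t: "0 \<le> t" "t \<le> 1" for t
  proof -
    have "of_real t * M1_example z \<in> M1_example ` cball 0 r"
    proof (rule Lim_in_closed_set)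
      show "closed (M1_example ` cball 0 r)"
        by (intro compact_imp_closed compact_continuous_image cont compact_cball)
      have ev: "eventually (\<lambda>s::real. s \<in> {0<..<1}) (at_left 1)"
        by (rule eventually_at_leftI) auto
      then show "eventually (\<lambda>s::real. of_real t * M1_example (of_real s * z) \<in> M1_example ` cball 0 r) (at_left 1)"
      proof eventually_elim
        case (elim s)
        then have "M1_example (of_real s * z) \<in> M1_example ` ball 0 r" using nz r0 by (auto simp: norm_mult)
        then have "closed_segment 0 (M1_example (of_real s * z)) \<subseteq> M1_example ` ball 0 r"
          using star unfolding starlike_domain_wrt_def by blast
        moreover have "of_real t * M1_example (of_real s * z) \<in> closed_segment 0 (M1_example (of_real s * z))"
          using t by (auto simp: in_segment scaleR_conv_of_real)
        ultimately show ?case using ball_subset_cball by blast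
      qed
      have "((\<lambda>s::real. M1_example (of_real s * z)) \<longlongrightarrow> M1_example (of_real 1 * z)) (at_left 1)"
      proof (rule continuous_on_tendsto_compose[OF cont])
        show "((\<lambda>s::real. of_real s * z) \<longlongrightarrow> of_real 1 * z) (at_left 1)" by (intro tendsto_intros)
        show "eventually (\<lambda>s::real. of_real s * z \<in> cball 0 r) (at_left 1)"
          using ev by eventually_elim (use nz r0 in \<open>auto simp: norm_mult\<close>)
      qed (use nz in auto)
      then show "((\<lambda>s::real. of_real t * M1_example (of_real s * z)) \<longlongrightarrow> of_real t * M1_example z) (at_left 1)"
        by (intro tendsto_intros) simp
    qed auto
    then obtain w where w: "norm w \<le> r" "of_real t * M1_example z = M1_example w" by auto
    define \<omega> where "\<omega> = 1 / (1 - w)"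
    note half = cball_half_plane[OF w(1) r(2), folded \<omega>_def]
    have Im: "Im \<omega> = t * Y" and Re: "(Re \<omega>)\<^sup>2 - Re \<omega> - (Im \<omega>)\<^sup>2 = t * p"
      using w(2) unfolding fz M1_example_half_plane[of w] \<omega>_def by (auto simp: complex_eq_iff)
    \<comment> \<open>The half plane selects the root of the quadratic equation for the real part of the preimage.\<close>
    have "1 / 4 + t * p + (t * Y)\<^sup>2 = (Re \<omega> - 1 / 2)\<^sup>2"
      unfolding Im[symmetric] Re[symmetric] by (simp add: power2_eq_square algebra_simps)
    then have "\<xi> t = Re \<omega>" using half(2) by (simp add: \<xi>_def)
    then show ?thesis using half(1) by (simp add: Q_def Im)
  qed
  have root: "1 / 4 + 1 * p + (1 * Y)\<^sup>2 = (X - 1 / 2)\<^sup>2"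
    by (simp add: p_def power2_eq_square algebra_simps)
  have sqrt_root: "sqrt ((X - 1 / 2)\<^sup>2) = X - 1 / 2" using X by simp
  have \<xi>1: "\<xi> 1 = X" unfolding \<xi>_def root sqrt_root by simp
  have Q1: "Q 1 = 0" using c1 by (simp add: Q_def \<xi>1 rc circle)
  define D where "D = (p + 2 * Y\<^sup>2) / (2 * X - 1)"
  have der\<xi>: "(\<xi> has_real_derivative D) (at 1)"
  proof -
    have inner: "((\<lambda>t. 1 / 4 + t * p + (t * Y)\<^sup>2) has_real_derivative p + 2 * Y\<^sup>2) (at 1)"
      by (auto intro!: derivative_eq_intros simp: power2_eq_square)
    have "((\<lambda>t. sqrt (1 / 4 + t * p + (t * Y)\<^sup>2)) has_real_derivative
        inverse (sqrt (1 / 4 + 1 * p + (1 * Y)\<^sup>2)) / 2 * (p + 2 * Y\<^sup>2)) (at 1)"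
      by (rule DERIV_chain2[OF DERIV_real_sqrt inner]) (use X in \<open>simp only: root; simp\<close>)
    moreover have "inverse (sqrt (1 / 4 + 1 * p + (1 * Y)\<^sup>2)) / 2 * (p + 2 * Y\<^sup>2) = D"
      unfolding root sqrt_root D_def using X by (simp add: field_simps)
    ultimately have "((\<lambda>t. sqrt (1 / 4 + t * p + (t * Y)\<^sup>2)) has_real_derivative D) (at 1)"
      by (simp only:)
    from DERIV_add[OF DERIV_const[of "1 / 2"] this] show ?thesis by (simp add: \<xi>_def)
  qed
  have derQ: "(Q has_real_derivative (1 - r\<^sup>2) * (2 * X * D + 2 * Y\<^sup>2) - 2 * D) (at 1)"
    unfolding Q_def using \<xi>1 by (auto intro!: derivative_eq_intros der\<xi> simp: power2_eq_square algebra_simps)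
  have "(1 - r\<^sup>2) * (2 * X * D + 2 * Y\<^sup>2) - 2 * D = 2 / c * (Y\<^sup>2 - d * D)"
    using c1 unfolding rc by (simp add: X_def field_simps)
  also have "\<dots> < 0"
  proof -
    have "Y\<^sup>2 * (2 * X - 1) < d * (p + 2 * Y\<^sup>2)"
    proof -
      have turning: "p + 2 * (d\<^sup>2 / 2) = 3 * d\<^sup>2 - 2 * c * d + d"
        using d2 unfolding p_def Y2 by (simp add: X_def power2_eq_square field_simps)
      have "d * (p + 2 * Y\<^sup>2) - Y\<^sup>2 * (2 * X - 1) = d\<^sup>2 * (4 * d - (3 * c - 3 / 2))"
        unfolding Y2 turning X_def by (simp add: power2_eq_square field_simps)
      also have "\<dots> > 0" using d0 d_lower by simp
      finally show ?thesis by simp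
    qed
    then have "Y\<^sup>2 < d * D" using X by (simp add: D_def field_simps)
    then show ?thesis using c1 by (simp add: field_simps)
  qed
  finally obtain e where e: "e > 0" "\<And>h. 0 < h \<Longrightarrow> h < e \<Longrightarrow> Q 1 < Q (1 - h)"
    using DERIV_neg_dec_left[OF derQ] by blast
  define k where "k = min (e / 2) 1"
  have "Q 1 < Q (1 - k)" using e by (auto simp: k_def)
  moreover have "Q (1 - k) \<le> 0" using e(1) by (intro Q_le) (auto simp: k_def)
  ultimately show False using Q1 by simp
qed

theorem theorem3p9:
  fixes r\<^sub>S :: real
  assumes "r\<^sub>S = radius_of_starlikeness M1"
  shows "4 * sqrt 2 - 5 \<le> r\<^sub>S \<and> r\<^sub>S \<le> 1 / 3 * sqrt (1 / 3 * (37 - 8 * sqrt 10))"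
proof -
  have "sqrt 2 < 3 / 2" by (rule real_less_lsqrt) (auto simp: power2_eq_square)
  moreover have "5 / 4 < sqrt 2" by (rule real_less_rsqrt) (auto simp: power2_eq_square)
  ultimately have radius: "0 < 4 * sqrt 2 - 5" "4 * sqrt 2 - 5 \<le> 1" by linarith+
  have attained: "4 * sqrt 2 - 5 \<le> r\<^sub>S" "r\<^sub>S \<le> 1"
    "\<And>r f. 0 < r \<Longrightarrow> r \<le> r\<^sub>S \<Longrightarrow> f \<in> M1 \<Longrightarrow> starlike_domain_wrt 0 (f ` ball 0 r)"
    unfolding assms
    by (rule radius_of_starlikeness_attained[OF radius]; (assumption | (rule M1_starlike_image; assumption)))+
  have "r\<^sub>S \<le> 1 / 3 * sqrt (1 / 3 * (37 - 8 * sqrt 10))"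
  proof (rule ccontr)
    assume "\<not> ?thesis"
    then obtain r where r: "1 / 3 * sqrt (1 / 3 * (37 - 8 * sqrt 10)) < r" "r < r\<^sub>S"
      using dense not_le by blast
    have "sqrt 10 < 4" by (rule real_less_lsqrt) auto
    then have "0 \<le> 1 / 3 * sqrt (1 / 3 * (37 - 8 * sqrt 10))" by simp
    then have "0 < r" using r(1) by linarith
    have "starlike_domain_wrt 0 (M1_example ` ball 0 r)"
      by (rule attained(3)[OF \<open>0 < r\<close> _ M1_example_in_M1]) (use r(2) in simp)
    moreover have "r < 1" using r(2) attained(2) by linarith
    ultimately show False using M1_example_not_starlike[OF r(1)] by blast
  qed
  with attained(1) show ?thesis by blast
qed

end
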